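(* Let $|\lambda q/b|<1$. With $x=\cos\vartheta$, define $p_k(x)$ as the $q$-integral $$p_k(x):=\frac{4(-i\sin\vartheta)}{(1-q)}\,\frac{(2ce^{i\vartheta};q)_\infty(2ce^{-i\vartheta};q)_\infty}{(q;q)_\infty(e^{2i\vartheta};q)_\infty(e^{-2i\vartheta};q)_\infty}\int_{\frac12e^{-i\vartheta}}^{\frac12e^{i\vartheta}}t^k\,\frac{(2qe^{i\vartheta}t;q)_\infty(2qe^{-i\vartheta}t;q)_\infty\left(-\frac{\lambda q}{4bct};q\right)_\infty}{(4ct;q)_\infty\left(\frac{q}{4ct};q\right)_\infty}\,d_qt .$$ Then $p_k(x)$ satisfies the recurrence relation $$xp_k(x)=p_{k+1}(x)+cq^kp_k(x)+\tfrac14\left(1+\lambda q^k/b\right)p_{k-1}(x),\qquad k>0.$$ Further, let $|\lambda q/(2bc)|<1$. Then, for $\operatorname{Im}(x)\ge0$, we have $$p_k(x)=\frac{e^{ik\vartheta}(2ce^{-i\vartheta};q)_k\left(-\frac{\lambda q}{2bc}e^{-i\vartheta};q\right)_\infty}{2^k\left(\frac{q}{2c}e^{-i\vartheta};q\right)_\infty}\;{}_2\phi_1\!\left[\begin{matrix}-bq^{-k}/\lambda,\;0\\ q^{1-k}e^{i\vartheta}/(2c)\end{matrix};q,-\frac{\lambda q}{2bc}e^{-i\vartheta}\right],$$ and, for $\operatorname{Im}(x)\le0$, we have $$p_k(x)=\frac{e^{-ik\vartheta}(2ce^{i\vartheta};q)_k\left(-\frac{\lambda q}{2bc}e^{i\vartheta};q\right)_\infty}{2^k\left(\frac{q}{2c}e^{i\vartheta};q\right)_\infty}\;{}_2\phi_1\!\left[\begin{matrix}-bq^{-k}/\lambda,\;0\\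 q^{1-k}e^{-i\vartheta}/(2c)\end{matrix};q,-\frac{\lambda q}{2bc}e^{i\vartheta}\right].$$
   Context: Here $b,c,\lambda$ are parameters and $q$ is the base, with $0<|q|<1$. In the case $\operatorname{Im}(x)\ge0$ the angle $\vartheta$ in $x=\cos\vartheta$ is taken so that $|e^{-i\vartheta}|\le1$, and in the case $\operatorname{Im}(x)\le0$ so that $|e^{i\vartheta}|\le1$. The $q$-rising factorials are $(a;q)_0=1$, $(a;q)_n=(1-a)(1-aq)\cdots(1-aq^{n-1})$ for $n\ge1$, and $(a;q)_\infty=\prod_{k\ge0}(1-aq^k)$. The $q$-integral is $$\int_\alpha^\beta f(t)\,d_qt=\beta(1-q)\sum_{n=0}^\infty q^nf(\beta q^n)-\alpha(1-q)\sum_{n=0}^\infty q^nf(\alpha q^n).$$ The basic hypergeometric series is $${}_2\phi_1\!\left[\begin{matrix}a_1,a_2\\ b_1\end{matrix};q,z\right]=\sum_{k=0}^\infty\frac{(a_1;q)_k(a_2;q)_k}{(q;q)_k(b_1;q)_k}z^k,\qquad |z|<1.$$ *)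

theory Defs
  imports "HOL-Analysis.Analysis"
begin

definition qpoch :: "complex \<Rightarrow> complex \<Rightarrow> nat \<Rightarrow> complex" where
  "qpoch a q n = (\<Prod>j<n. 1 - a * q ^ j)"

definition qpoch_inf :: "complex \<Rightarrow> complex \<Rightarrow> complex" where
  "qpoch_inf a q = (\<Prod>j. 1 - a * q ^ j)"

definition q_integral ::
    "complex \<Rightarrow> complex \<Rightarrow> complex \<Rightarrow> (complex \<Rightarrow> complex) \<Rightarrow> complex" where
  "q_integral q \<alpha> \<beta> f =
     \<beta> * (1 - q) * (\<Sum>n. q ^ n * f (\<beta> * q ^ n))
     - \<alpha> * (1 - q) * (\<Sum>n. q ^ n * f (\<alpha> * q ^ n))"

definition phi21 ::
    "complex \<Rightarrow> complex \<Rightarrow> complex \<Rightarrow> complex \<Rightarrow> complex \<Rightarrow> complex" where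
  "phi21 a1 a2 b1 q z =
     (\<Sum>k. qpoch a1 q k * qpoch a2 q k / (qpoch q q k * qpoch b1 q k) * z ^ k)"

definition p_integrand ::
    "complex \<Rightarrow> complex \<Rightarrow> complex \<Rightarrow> complex \<Rightarrow> complex \<Rightarrow> nat \<Rightarrow> complex \<Rightarrow> complex" where
  "p_integrand q b c lam \<theta> k t =
     t ^ k *
     (qpoch_inf (2 * q * exp (\<i> * \<theta>) * t) q * qpoch_inf (2 * q * exp (- \<i> * \<theta>) * t) q
        * qpoch_inf (- (lam * q / (4 * b * c * t))) q)
     / (qpoch_inf (4 * c * t) q * qpoch_inf (q / (4 * c * t)) q)"

text \<open>The function \<open>p_k(x)\<close> with \<open>x = cos \<theta>\<close>, written in terms of the angle. By
  \<open>p_fun_cong_cos\<close> below its value depends on \<open>\<theta>\<close> only through \<open>x\<close>.\<close>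

definition p_fun ::
    "complex \<Rightarrow> complex \<Rightarrow> complex \<Rightarrow> complex \<Rightarrow> complex \<Rightarrow> nat \<Rightarrow> complex" where
  "p_fun q b c lam \<theta> k =
     4 * (- \<i> * sin \<theta>) / (1 - q)
     * (qpoch_inf (2 * c * exp (\<i> * \<theta>)) q * qpoch_inf (2 * c * exp (- \<i> * \<theta>)) q
        / (qpoch_inf q q * qpoch_inf (exp (2 * \<i> * \<theta>)) q * qpoch_inf (exp (- 2 * \<i> * \<theta>)) q))
     * q_integral q (exp (- \<i> * \<theta>) / 2) (exp (\<i> * \<theta>) / 2) (p_integrand q b c lam \<theta> k)"

text \<open>No denominator in the definition of \<open>p_fun\<close> vanishes (when \<open>0 < |q| < 1\<close> and
  \<open>b, c \<noteq> 0\<close>). The prefactor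
  contains \<open>(e^{2i\<theta>};q)_\<infinity> (e^{-2i\<theta>};q)_\<infinity>\<close>, which is zero iff \<open>e^{2i\<theta>}\<close> is an integer power
  of \<open>q\<close>. At the nodes \<open>t = e^{\<plusminus>i\<theta>} q^n / 2\<close> the integrand has the denominator
  \<open>(4ct;q)_\<infinity> (q/(4ct);q)_\<infinity>\<close>, which is zero iff \<open>2c e^{\<plusminus>i\<theta>}\<close> is an integer power of \<open>q\<close>. The
  last two conditions also keep the denominators of the two series representations nonzero.\<close>

definition p_nondegenerate :: "complex \<Rightarrow> complex \<Rightarrow> complex \<Rightarrow> bool" where
  "p_nondegenerate q c \<theta> \<longleftrightarrow>
     (\<forall>m::int. exp (2 * \<i> * \<theta>) \<noteq> q powi m
        \<and> 2 * c * exp (\<i> * \<theta>) \<noteq> q powi m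
        \<and> 2 * c * exp (- \<i> * \<theta>) \<noteq> q powi m)"

lemma p_fun_minus: "p_fun q b c lam (- \<theta>) k = p_fun q b c lam \<theta> k"
proof -
  have f: "p_integrand q b c lam (- \<theta>) k = p_integrand q b c lam \<theta> k"
    by (rule ext) (simp add: p_integrand_def mult_ac)
  have q: "q_integral q (exp (\<i> * \<theta>) / 2) (exp (- (\<i> * \<theta>)) / 2) f
      = - q_integral q (exp (- (\<i> * \<theta>)) / 2) (exp (\<i> * \<theta>) / 2) f" for f
    by (simp add: q_integral_def)
  have "4 * (- \<i> * - s) / d * (A * B / (C * E * F)) * (- I)
      = 4 * (- \<i> * s) / d * (B * A / (C * F * E)) * I" for s d A B C E F I :: complex
    by (simp add: mult_ac)
  then show ?thesis
    unfolding p_fun_def f by (simp only: mult_minus_left mult_minus_right minus_minus sin_minus q)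
qed

lemma p_fun_cong_exp:
  assumes "exp (\<i> * \<theta>) = exp (\<i> * \<theta>')"
  shows "p_fun q b c lam \<theta> k = p_fun q b c lam \<theta>' k"
proof -
  have m: "exp (- (\<i> * \<theta>)) = exp (- (\<i> * \<theta>'))"
    using assms by (simp add: exp_minus)
  have d: "exp (2 * \<i> * \<theta>) = exp (2 * \<i> * \<theta>')" "exp (- (2 * \<i> * \<theta>)) = exp (- (2 * \<i> * \<theta>'))"
    using exp_double[of "\<i> * \<theta>"] exp_double[of "\<i> * \<theta>'"] assms
    by (simp_all add: exp_minus mult.assoc)
  have s: "sin \<theta> = sin \<theta>'"
    using assms m by (simp add: sin_exp_eq)
  have "p_integrand q b c lam \<theta> k = p_integrand q b c lam \<theta>' k"
    using assms m by (intro ext) (simp add: p_integrand_def)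
  then show ?thesis
    using assms m d s by (simp add: p_fun_def)
qed

lemma p_fun_cong_cos:
  assumes "cos \<theta> = cos \<theta>'"
  shows "p_fun q b c lam \<theta> k = p_fun q b c lam \<theta>' k"
proof -
  have alg: "u = v \<or> u = inverse v"
    if "(u + inverse u) / 2 = (v + inverse v) / 2" "u \<noteq> 0" "v \<noteq> 0" for u v :: complex
  proof -
    have "u + inverse u = v + inverse v"
      using that(1) by (metis divide_cancel_right zero_neq_numeral)
    then have "u * v * (u + inverse u) = u * v * (v + inverse v)"
      by simp
    moreover have "u * v * (u + inverse u) = u * u * v + v"
      "u * v * (v + inverse v) = u * v * v + u"
      using that(2,3) by (simp_all add: distrib_left)
    ultimately have "(u - v) * (u * v - 1) = 0"
      by (simp add: algebra_simps)
    then have "u - v = 0 \<or> u * v - 1 = 0"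
      by (simp only: mult_eq_0_iff)
    then show ?thesis
      by (metis eq_iff_diff_eq_0 inverse_unique mult.commute)
  qed
  have "exp (\<i> * \<theta>) = exp (\<i> * \<theta>') \<or> exp (\<i> * \<theta>) = inverse (exp (\<i> * \<theta>'))"
    using assms by (intro alg) (simp_all only: cos_exp_eq exp_minus exp_not_eq_zero mult_minus_left not_False_eq_True)
  then show ?thesis
  proof
    assume "exp (\<i> * \<theta>) = inverse (exp (\<i> * \<theta>'))"
    then have "exp (\<i> * \<theta>) = exp (\<i> * (- \<theta>'))"
      by (simp only: exp_minus mult_minus_right)
    then show ?thesis
      using p_fun_cong_exp p_fun_minus by metis
  qed (rule p_fun_cong_exp)
qed

end

theory Submission
  imports Defs
begin

text \<open>Write \<open>u = e\<^bsup>i\<theta>\<^esup>\<close>, \<open>v = 1/u\<close>, \<open>X = 2cu\<close>, \<open>Y = 2cv\<close>, \<open>z = -\<lambda>q/b\<close> and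
\<open>\<Theta>(x) = (x;q)\<^sub>\<infinity>(q/x;q)\<^sub>\<infinity>\<close>. The \<open>q\<close>-integral is a combination of two sums, over the nodes
\<open>uq\<^sup>n/2\<close> and over the nodes \<open>vq\<^sup>n/2\<close>.

The recurrence is a \<open>q\<close>-analogue of integration by parts. Let \<open>w\<close> be the weight, that is, the
integrand without \<open>t\<^sup>k\<close>, and \<open>G(t) = t\<^sup>k(1 - 2ut)(1 - 2vt)w(t)\<close>. The \<open>q\<close>-shift of the weight
(\<open>weight_shift\<close>) turns \<open>G(t) - G(qt)\<close> into \<open>-4t\<close> times the combination of integrands that the
recurrence says has integral zero, so both sums telescope. Their boundary terms vanish: \<open>G\<close> is zero at
\<open>u/2\<close> and \<open>v/2\<close> because of its two linear factors, and tends to zero along the nodes because the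
sums converge (\<open>node_sum_recurrence\<close>).

For the closed form, shifting \<open>k\<close> amounts to replacing \<open>(X, Y, z)\<close> by \<open>(Xq\<^sup>k, Yq\<^sup>k, zq\<^sup>k)\<close>. Up to
explicit factors the two node sums are then \<open>lattice_series X Y z\<close> and \<open>lattice_series Y X z\<close>,
and what is needed is a three-term connection formula that combines them, with theta functions as
coefficients, into one series (\<open>lattice_three_term\<close>). Heine's transformation turns that one series
into the \<open>\<^sub>2\<phi>\<^sub>1\<close> of the theorem (\<open>connection_series_eq_phi21\<close>).

The connection formula follows from its case \<open>z = 0\<close>, because the coefficient of each power
\<open>z\<^sup>l\<close> is the case \<open>z = 0\<close> at the arguments \<open>X/q\<^sup>l\<close> and \<open>Y/q\<^sup>l\<close>. With the double series
\<open>H(\<alpha>,\<beta>) = \<Sum> (-q)\<^bsup>i+j\<^esup> q\<^bsup>(i+j)(i+j-1)/2\<^esup> \<alpha>\<^sup>i \<beta>\<^sup>j / ((q;q)\<^sub>i (q;q)\<^sub>j)\<close> (\<open>double_euler\<close>) that case reads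
\<open>\<Theta>(Y) H(X, X/Y) - (Y/X) \<Theta>(X) H(Y, Y/X) = \<Theta>(Y/X) H(1/X, 1/Y)\<close> (\<open>theta_three_term\<close>).
By the Jacobi triple product (\<open>has_sum_theta\<close>) all three products are double Laurent series in \<open>X\<close> and
\<open>Y\<close> that converge absolutely. After linear substitutions of the indices they all have the same coefficients
(\<open>has_sum_theta_double_euler\<close>), so the identity reduces to one relation between three
\<open>q\<close>-binomial-type numbers (\<open>laurent_coeff_relation\<close>).\<close>

section \<open>Triangular numbers and finite products\<close>

text \<open>Binomial coefficients \<open>b choose 2\<close> extended to negative \<open>b\<close>, as the exponents of a theta series need.\<close>

definition tri :: "int \<Rightarrow> int" where "tri b = b * (b - 1) div 2"

lemma two_tri: "2 * tri b = b * (b - 1)"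
  unfolding tri_def by (simp add: algebra_simps)

lemma tri_add: "tri (a + b) = tri a + tri b + a * b"
proof -
  have "2 * tri (a + b) = 2 * (tri a + tri b + a * b)"
    unfolding distrib_left two_tri by (simp add: algebra_simps)
  then show ?thesis by simp
qed

lemma tri_uminus: "tri (- b) = tri b + b"
proof -
  have "2 * tri (- b) = 2 * (tri b + b)"
    unfolding distrib_left two_tri by (simp add: algebra_simps)
  then show ?thesis by simp
qed

lemma tri_simps [simp]: "tri 0 = 0" "tri 1 = 0"
  by (simp_all add: tri_def)

lemma tri_nonneg: "tri b \<ge> 0"
proof -
  have "b * (b - 1) \<ge> 0"
    by (cases "b \<ge> 1") (auto intro: mult_nonpos_nonpos)
  then show ?thesis by (simp add: tri_def)
qed

lemma qpoch_0 [simp]: "qpoch a q 0 = 1"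
  by (simp add: qpoch_def)

lemma qpoch_Suc: "qpoch a q (Suc n) = qpoch a q n * (1 - a * q ^ n)"
  by (simp add: qpoch_def)

lemma qpoch_add: "qpoch a q (m + n) = qpoch a q m * qpoch (a * q ^ m) q n"
  by (induction n) (simp_all add: qpoch_Suc power_add mult_ac)

lemma qpoch_zero_left [simp]: "qpoch 0 q n = 1"
  by (simp add: qpoch_def)

lemma qpoch_eq_0I: "a * q ^ j = 1 \<Longrightarrow> j < n \<Longrightarrow> qpoch a q n = 0"
  unfolding qpoch_def by (rule prod_zero) auto

section \<open>Infinite products, Euler and q-binomial series\<close>

locale qbase =
  fixes q :: complex
  assumes q0: "q \<noteq> 0" and q1: "norm q < 1"
begin

lemma q_power_neq_1: "q ^ Suc n \<noteq> 1"
proof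
  assume "q ^ Suc n = 1"
  then have "norm q ^ Suc n = 1"
    by (metis norm_one norm_power)
  moreover have "norm q ^ Suc n < 1"
    using q1 by (intro power_Suc_less_one) (use q0 in auto)
  ultimately show False by simp
qed

lemma summable_q_power: "summable (\<lambda>j. norm (a * q ^ j))"
  using q1 by (simp add: norm_mult norm_power summable_mult)

lemma convergent_qpoch: "convergent_prod (\<lambda>j. 1 - a * q ^ j)"
  by (rule abs_convergent_prod_imp_convergent_prod)
     (use summable_q_power[of a] in \<open>simp add: abs_convergent_prod_conv_summable\<close>)

lemma qpoch_tendsto: "(\<lambda>n. qpoch a q n) \<longlonglongrightarrow> qpoch_inf a q"
  unfolding qpoch_def qpoch_inf_def
  using has_prod_imp_tendsto'[OF convergent_prod_has_prod[OF convergent_qpoch]] .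

lemma qpoch_inf_split: "qpoch_inf a q = qpoch a q n * qpoch_inf (a * q ^ n) q"
proof -
  have "(\<lambda>m. qpoch a q (n + m)) \<longlonglongrightarrow> qpoch_inf a q"
    using LIMSEQ_ignore_initial_segment[OF qpoch_tendsto[of a], of n] by (simp add: add.commute)
  moreover have "(\<lambda>m. qpoch a q (n + m)) \<longlonglongrightarrow> qpoch a q n * qpoch_inf (a * q ^ n) q"
    unfolding qpoch_add by (intro tendsto_intros qpoch_tendsto)
  ultimately show ?thesis by (rule LIMSEQ_unique)
qed

lemma qpoch_inf_Suc: "qpoch_inf a q = (1 - a) * qpoch_inf (a * q) q"
  using qpoch_inf_split[of a 1] by (simp add: qpoch_Suc)

lemma qpoch_inf_nonzero: "(\<And>j. a * q ^ j \<noteq> 1) \<Longrightarrow> qpoch_inf a q \<noteq> 0"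
  unfolding qpoch_inf_def by (intro prodinf_nonzero convergent_qpoch) auto

lemma qpoch_nonzero: "qpoch_inf a q \<noteq> 0 \<Longrightarrow> qpoch a q n \<noteq> 0"
  using qpoch_inf_split[of a n] by auto

abbreviation qq :: "nat \<Rightarrow> complex" where "qq \<equiv> qpoch q q"

lemma qq_inf_nonzero [simp]: "qpoch_inf q q \<noteq> 0"
  using q_power_neq_1 by (intro qpoch_inf_nonzero) simp

lemma qq_nonzero [simp]: "qq n \<noteq> 0"
  by (rule qpoch_nonzero) simp

lemma qq_Suc: "qq (Suc n) = qq n * (1 - q ^ Suc n)"
  by (simp add: qpoch_Suc)

text \<open>From the first index on after which no factor vanishes, the values are a constant divided by partial products that
  converge to a nonzero limit.\<close>

lemma qpoch_shift_bound:
  obtains K where "K > 0" "\<And>n. norm (qpoch_inf (a * q ^ n) q) \<le> K"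
proof (cases "\<exists>m. \<forall>j\<ge>m. a * q ^ j \<noteq> 1")
  case True
  then obtain m where m: "\<And>j. j \<ge> m \<Longrightarrow> a * q ^ j \<noteq> 1" by auto
  have nz: "qpoch_inf (a * q ^ m) q \<noteq> 0"
    by (rule qpoch_inf_nonzero) (use m in \<open>simp add: mult.assoc flip: power_add\<close>)
  have "(\<lambda>n. qpoch_inf (a * q ^ m) q / qpoch (a * q ^ m) q n)
      \<longlonglongrightarrow> qpoch_inf (a * q ^ m) q / qpoch_inf (a * q ^ m) q"
    by (intro tendsto_intros qpoch_tendsto nz)
  moreover have "qpoch_inf (a * q ^ m) q / qpoch (a * q ^ m) q n = qpoch_inf (a * q ^ (n + m)) q" for n
    using qpoch_inf_split[of "a * q ^ m" n] qpoch_nonzero[OF nz, of n]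
    by (simp add: power_add mult_ac)
  ultimately have "convergent (\<lambda>n. qpoch_inf (a * q ^ (n + m)) q)"
    by (auto simp: convergent_def)
  then have "convergent (\<lambda>n. qpoch_inf (a * q ^ n) q)"
    using convergent_ignore_initial_segment[of "\<lambda>n. qpoch_inf (a * q ^ n) q" m] by simp
  then have "Bseq (\<lambda>n. qpoch_inf (a * q ^ n) q)"
    by (rule convergent_imp_Bseq)
  then show ?thesis using that by (auto simp: Bseq_def)
next
  case False
  have "(\<lambda>j. norm (a * q ^ j)) \<longlonglongrightarrow> 0"
    by (rule summable_LIMSEQ_zero[OF summable_q_power])
  then have "eventually (\<lambda>j. norm (a * q ^ j) < 1) sequentially"
    by (rule order_tendstoD) simp
  then obtain m where "\<And>j. j \<ge> m \<Longrightarrow> norm (a * q ^ j) < 1"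
    by (auto simp: eventually_sequentially)
  then have "\<And>j. j \<ge> m \<Longrightarrow> a * q ^ j \<noteq> 1" by fastforce
  with False show ?thesis by blast
qed

lemma qq_inverse_bound:
  obtains K where "K > 0" "\<And>n. norm (1 / qq n) \<le> K"
proof -
  have "(\<lambda>n. 1 / qq n) \<longlonglongrightarrow> 1 / qpoch_inf q q"
    by (intro tendsto_intros qpoch_tendsto) simp
  then have "Bseq (\<lambda>n. 1 / qq n)"
    by (intro convergent_imp_Bseq) (auto simp: convergent_def)
  then show ?thesis using that by (auto simp: Bseq_def)
qed

text \<open>The coefficients \<open>(-1)\<^sup>b q\<^bsup>b(b-1)/2\<^esup>\<close> of the theta series. The rule \<open>tau_add\<close> makes them a
  quadratic analogue of powers, and every exponent of \<open>q\<close> below is handled through it.\<close>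

definition tau :: "int \<Rightarrow> complex" where
  "tau b = (- 1) powi b * q powi tri b"

lemma tau_add: "tau (a + b) = tau a * tau b * q powi (a * b)"
  using q0 by (simp add: tau_def tri_add power_int_add)

lemma tau_0 [simp]: "tau 0 = 1" and tau_1 [simp]: "tau 1 = - 1"
  by (simp_all add: tau_def)

lemma tau_Suc: "tau (int (Suc n)) = - (tau (int n) * q ^ n)"
  using tau_add[of "int n" 1] by (simp add: add.commute)

lemma tau_uminus: "tau (- b) = tau b * q powi b"
  using q0 by (simp add: tau_def tri_uminus power_int_add power_int_minus flip: power_int_inverse)

lemma tau_nonzero [simp]: "tau b \<noteq> 0"
  using q0 by (simp add: tau_def)

lemma summable_tau: "summable (\<lambda>n. norm (tau (int n) * x ^ n))"
proof -
  have "(\<lambda>n. norm q ^ n * norm x) \<longlonglongrightarrow> 0 * norm x"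
    using q1 by (intro tendsto_intros LIMSEQ_power_zero) simp
  then have "eventually (\<lambda>n. norm q ^ n * norm x < 1 / 2) sequentially"
    by (rule order_tendstoD(2)) simp
  then obtain N where N: "\<And>n. n \<ge> N \<Longrightarrow> norm q ^ n * norm x < 1 / 2"
    by (auto simp: eventually_sequentially)
  show ?thesis
  proof (rule summable_ratio_test)
    fix n assume "n \<ge> N"
    have "norm (norm (tau (int (Suc n)) * x ^ Suc n)) =
        (norm q ^ n * norm x) * norm (norm (tau (int n) * x ^ n))"
      by (simp only: tau_Suc) (simp add: norm_mult norm_power mult_ac)
    also have "\<dots> \<le> 1 / 2 * norm (norm (tau (int n) * x ^ n))"
      using N[OF \<open>n \<ge> N\<close>] by (intro mult_right_mono) auto
    finally show "norm (norm (tau (int (Suc n)) * x ^ Suc n)) \<le> 1 / 2 * norm (norm (tau (int n) * x ^ n))" .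
  qed simp
qed

definition euler_coeff :: "nat \<Rightarrow> complex" where
  "euler_coeff n = tau (int n) / qq n"

lemma summable_euler: "summable (\<lambda>n. norm (euler_coeff n * x ^ n))"
proof -
  obtain K where K: "K > 0" "\<And>n. norm (1 / qq n) \<le> K" by (rule qq_inverse_bound) auto
  show ?thesis
  proof (rule summable_comparison_test')
    show "summable (\<lambda>n. K * norm (tau (int n) * x ^ n))"
      by (intro summable_mult summable_tau)
    fix n
    have "norm (euler_coeff n * x ^ n) = norm (1 / qq n) * norm (tau (int n) * x ^ n)"
      by (simp add: euler_coeff_def norm_mult norm_divide)
    also have "\<dots> \<le> K * norm (tau (int n) * x ^ n)"
      by (intro mult_right_mono K) simp
    finally show "norm (norm (euler_coeff n * x ^ n)) \<le> K * norm (tau (int n) * x ^ n)" by simp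
  qed
qed

lemma euler_coeff_0 [simp]: "euler_coeff 0 = 1"
  by (simp add: euler_coeff_def)

lemma euler_coeff_Suc: "euler_coeff (Suc n) * (1 - q ^ Suc n) = - (euler_coeff n * q ^ n)"
  using q_power_neq_1[of n] unfolding euler_coeff_def qq_Suc tau_Suc by (simp add: divide_simps)

text \<open>Euler's expansion: the power series solves \<open>f(x) = (1 - x) f(qx)\<close>, and iterating this functional equation
  with \<open>f\<close> continuous at zero gives the product.\<close>

lemma suminf_euler: "(\<Sum>n. euler_coeff n * x ^ n) = qpoch_inf x q"
proof -
  define f where "f x = (\<Sum>n. euler_coeff n * x ^ n)" for x
  have sm: "summable (\<lambda>n. euler_coeff n * x ^ n)" for x
    by (rule summable_norm_cancel[OF summable_euler])
  have step: "f x = (1 - x) * f (x * q)" for x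
  proof -
    have "f x - f (x * q) = (\<Sum>n. euler_coeff n * (1 - q ^ n) * x ^ n)"
      unfolding f_def by (subst suminf_diff[OF sm sm]) (simp add: algebra_simps power_mult_distrib)
    also have "\<dots> = (\<Sum>n. euler_coeff (Suc n) * (1 - q ^ Suc n) * x ^ Suc n)"
    proof (subst suminf_split_head)
      have "(\<lambda>n. euler_coeff n * (1 - q ^ n) * x ^ n)
          = (\<lambda>n. euler_coeff n * x ^ n - euler_coeff n * (x * q) ^ n)"
        by (simp add: algebra_simps power_mult_distrib)
      then show "summable (\<lambda>n. euler_coeff n * (1 - q ^ n) * x ^ n)"
        by (simp only: summable_diff[OF sm sm])
    qed simp
    also have "\<dots> = (\<Sum>n. - x * (euler_coeff n * (x * q) ^ n))"
      unfolding euler_coeff_Suc by (simp add: power_mult_distrib mult_ac)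
    also have "\<dots> = - x * f (x * q)"
      unfolding f_def by (rule suminf_mult[OF sm])
    finally show ?thesis by (simp add: algebra_simps)
  qed
  have it: "f x = qpoch x q n * f (x * q ^ n)" for n
  proof (induction n)
    case (Suc n)
    then show ?case using step[of "x * q ^ n"] by (simp add: qpoch_Suc mult_ac)
  qed simp
  have "isCont f 0"
    unfolding f_def using sm by (rule isCont_powser_converges_everywhere)
  moreover have "(\<lambda>n. x * q ^ n) \<longlonglongrightarrow> 0"
    by (rule summable_LIMSEQ_zero[OF summable_norm_cancel[OF summable_q_power]])
  ultimately have "(\<lambda>n. f (x * q ^ n)) \<longlonglongrightarrow> f 0"
    by (rule isCont_tendsto_compose)
  then have "(\<lambda>n. qpoch x q n * f (x * q ^ n)) \<longlonglongrightarrow> qpoch_inf x q * f 0"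
    by (intro tendsto_intros qpoch_tendsto)
  then have "f x = qpoch_inf x q * f 0"
    unfolding it[symmetric] by (simp add: LIMSEQ_const_iff)
  moreover have "f 0 = 1"
    unfolding f_def by (simp add: powser_zero)
  ultimately show ?thesis by (simp add: f_def)
qed

lemma has_sum_euler: "((\<lambda>n. euler_coeff n * x ^ n) has_sum qpoch_inf x q) UNIV"
  using norm_summable_imp_has_sum[OF summable_euler
      summable_sums[OF summable_norm_cancel[OF summable_euler]]]
  by (simp add: suminf_euler)

text \<open>Coefficients of the \<open>q\<close>-binomial series \<open>\<^sub>1\<phi>\<^sub>0(A; q, x)\<close>.\<close>

definition binom_coeff :: "complex \<Rightarrow> nat \<Rightarrow> complex" where
  "binom_coeff A n = qpoch A q n / qq n"

lemma qpoch_bound: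
  obtains K where "K > 0" "\<And>n. norm (qpoch a q n) \<le> K"
  using convergent_imp_Bseq[of "qpoch a q"] qpoch_tendsto[of a]
  by (auto simp: Bseq_def convergent_def)

lemma binom_coeff_bound:
  obtains K where "K > 0" "\<And>n. norm (binom_coeff A n) \<le> K"
proof -
  obtain K where K: "K > 0" "\<And>n. norm (1 / qq n) \<le> K" by (rule qq_inverse_bound) auto
  obtain L where L: "L > 0" "\<And>n. norm (qpoch A q n) \<le> L" by (rule qpoch_bound) auto
  have "norm (binom_coeff A n) \<le> L * K" for n
  proof -
    have "norm (binom_coeff A n) = norm (qpoch A q n) * norm (1 / qq n)"
      by (simp add: binom_coeff_def norm_mult norm_divide)
    also have "\<dots> \<le> L * K" by (intro mult_mono K L) (use L in auto)
    finally show ?thesis .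
  qed
  with K L show ?thesis by (intro that[of "L * K"]) auto
qed

lemma summable_binom: "norm x < 1 \<Longrightarrow> summable (\<lambda>n. norm (binom_coeff A n * x ^ n))"
proof -
  assume x: "norm x < 1"
  obtain K where K: "K > 0" "\<And>n. norm (binom_coeff A n) \<le> K" by (rule binom_coeff_bound) auto
  show ?thesis
  proof (rule summable_comparison_test')
    show "summable (\<lambda>n. K * norm x ^ n)"
      using x by (intro summable_mult summable_geometric) simp
    show "norm (norm (binom_coeff A n * x ^ n)) \<le> K * norm x ^ n" for n
      using K(2)[of n] by (simp add: norm_mult norm_power mult_right_mono)
  qed
qed

lemma binom_coeff_0 [simp]: "binom_coeff A 0 = 1"
  by (simp add: binom_coeff_def)

lemma binom_coeff_Suc: "binom_coeff A (Suc n) * (1 - q ^ Suc n) = binom_coeff A n * (1 - A * q ^ n)"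
  using q_power_neq_1[of n] unfolding binom_coeff_def qq_Suc by (simp add: qpoch_Suc divide_simps)

text \<open>The same argument as for Euler's series, with the functional equation
  \<open>(1 - x) f(x) = (1 - Ax) f(qx)\<close>.\<close>

lemma suminf_binom:
  assumes "norm x < 1"
  shows "qpoch_inf x q * (\<Sum>n. binom_coeff A n * x ^ n) = qpoch_inf (A * x) q"
proof -
  define f where "f x = (\<Sum>n. binom_coeff A n * x ^ n)" for x
  have sm: "summable (\<lambda>n. binom_coeff A n * x ^ n)" if "norm x < 1" for x
    by (rule summable_norm_cancel[OF summable_binom[OF that]])
  have xq: "norm (x * q ^ n) < 1" if "norm x < 1" for x n
  proof -
    have "norm q ^ n \<le> 1" using q1 by (intro power_le_one) auto
    then have "norm x * norm q ^ n \<le> norm x" by (intro mult_left_le) auto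
    with that show ?thesis by (simp add: norm_mult norm_power)
  qed
  have step: "(1 - x) * f x = (1 - A * x) * f (x * q)" if x: "norm x < 1" for x
  proof -
    note s = sm[OF x] and s' = sm[of "x * q", OF xq[OF x, of 1, simplified]]
    have "f x - f (x * q) = (\<Sum>n. binom_coeff A n * (1 - q ^ n) * x ^ n)"
      unfolding f_def by (subst suminf_diff[OF s s']) (simp add: algebra_simps power_mult_distrib)
    also have "\<dots> = (\<Sum>n. binom_coeff A (Suc n) * (1 - q ^ Suc n) * x ^ Suc n)"
    proof (subst suminf_split_head)
      have "(\<lambda>n. binom_coeff A n * (1 - q ^ n) * x ^ n)
          = (\<lambda>n. binom_coeff A n * x ^ n - binom_coeff A n * (x * q) ^ n)"
        by (simp add: algebra_simps power_mult_distrib)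
      then show "summable (\<lambda>n. binom_coeff A n * (1 - q ^ n) * x ^ n)"
        by (simp only: summable_diff[OF s s'])
    qed simp
    also have "\<dots> = (\<Sum>n. x * (binom_coeff A n * x ^ n) - A * x * (binom_coeff A n * (x * q) ^ n))"
      unfolding binom_coeff_Suc by (simp add: power_mult_distrib algebra_simps)
    also have "\<dots> = x * f x - A * x * f (x * q)"
      unfolding f_def by (subst suminf_diff[symmetric])
        (use s s' in \<open>auto intro!: summable_mult simp: suminf_mult\<close>)
    finally show ?thesis by (simp add: algebra_simps)
  qed
  have it: "qpoch x q n * f x = qpoch (A * x) q n * f (x * q ^ n)" for n
  proof (induction n)
    case (Suc n)
    have "qpoch x q (Suc n) * f x = (1 - x * q ^ n) * (qpoch x q n * f x)"
      by (simp add: qpoch_Suc mult_ac)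
    also have "\<dots> = qpoch (A * x) q n * ((1 - x * q ^ n) * f (x * q ^ n))"
      unfolding Suc.IH by (simp add: mult_ac)
    also have "\<dots> = qpoch (A * x) q (Suc n) * f (x * q ^ Suc n)"
      unfolding step[OF xq[OF assms]] by (simp add: qpoch_Suc mult_ac)
    finally show ?case .
  qed simp
  have "isCont f 0"
    unfolding f_def by (rule isCont_powser[of _ "1/2"]) (auto intro: sm)
  moreover have "(\<lambda>n. x * q ^ n) \<longlonglongrightarrow> 0"
    by (rule summable_LIMSEQ_zero[OF summable_norm_cancel[OF summable_q_power]])
  ultimately have "(\<lambda>n. f (x * q ^ n)) \<longlonglongrightarrow> f 0"
    by (rule isCont_tendsto_compose)
  then have "(\<lambda>n. qpoch (A * x) q n * f (x * q ^ n)) \<longlonglongrightarrow> qpoch_inf (A * x) q * f 0"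
    by (intro tendsto_intros qpoch_tendsto)
  moreover have "(\<lambda>n. qpoch (A * x) q n * f (x * q ^ n)) \<longlonglongrightarrow> qpoch_inf x q * f x"
    unfolding it[symmetric] by (intro tendsto_intros qpoch_tendsto)
  ultimately have "qpoch_inf (A * x) q * f 0 = qpoch_inf x q * f x"
    by (rule LIMSEQ_unique)
  moreover have "f 0 = 1"
    unfolding f_def by (simp add: powser_zero)
  ultimately show ?thesis by (simp add: f_def)
qed

lemma has_sum_binom:
  assumes "norm x < 1" "qpoch_inf x q \<noteq> 0"
  shows "((\<lambda>n. binom_coeff A n * x ^ n) has_sum qpoch_inf (A * x) q / qpoch_inf x q) UNIV"
proof -
  have "(\<Sum>n. binom_coeff A n * x ^ n) = qpoch_inf (A * x) q / qpoch_inf x q"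
    using suminf_binom[OF assms(1), of A] assms(2) by (simp add: divide_simps mult_ac)
  then show ?thesis
    using norm_summable_imp_has_sum[OF summable_binom[OF assms(1)]
        summable_sums[OF summable_norm_cancel[OF summable_binom[OF assms(1)]]], of A] by simp
qed

end

lemma has_sum_complex_product:
  fixes f :: "'a \<Rightarrow> complex" and g :: "'b \<Rightarrow> complex"
  assumes f: "(f has_sum s) A" and g: "(g has_sum t) B"
  shows "((\<lambda>(x, y). f x * g y) has_sum (s * t)) (A \<times> B)"
proof (rule has_sum_SigmaI)
  show "((\<lambda>y. case (x, y) of (x, y) \<Rightarrow> f x * g y) has_sum f x * t) B" for x
    using has_sum_cmult_right[OF g] by simp
  show "((\<lambda>x. f x * t) has_sum s * t) A"
    by (rule has_sum_cmult_left[OF f])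
  have fa: "(\<lambda>x. norm (f x)) summable_on A" and ga: "(\<lambda>x. norm (g x)) summable_on B"
    using f g summable_on_iff_abs_summable_on_complex by (auto simp: summable_on_def)
  have "(\<lambda>p. norm ((\<lambda>(x, y). f x * g y) p)) summable_on (A \<times> B)"
    unfolding Infinite_Sum.abs_summable_on_Sigma_iff
    using fa ga by (auto simp: norm_mult infsum_cmult_right infsum_nonneg intro!: summable_on_cmult_right summable_on_cmult_left)
  then show "(\<lambda>(x, y). f x * g y) summable_on A \<times> B"
    by (rule abs_summable_summable)
qed

context qbase begin

section \<open>The Jacobi triple product\<close>

text \<open>The summand of Cauchy's identity, in which a partition is cut at its Durfee rectangle of size \<open>n \<times> (n + N)\<close>.\<close>

definition durfee :: "nat \<Rightarrow> nat \<Rightarrow> complex" where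
  "durfee N n = q ^ (n * n + n * N) / (qq n * qq (n + N))"

text \<open>This makes \<open>durfee N n - durfee (Suc N) n\<close> a difference of consecutive values of
  \<open>(1 - q\<^sup>n) * durfee N n\<close>, so the sum over \<open>n\<close> cannot depend on \<open>N\<close>.\<close>

lemma durfee_step: "durfee (Suc N) n = q ^ n * durfee N n + (1 - q ^ Suc n) * durfee N (Suc n)"
proof -
  have nz: "1 - q ^ Suc n \<noteq> 0" "1 - q ^ Suc (n + N) \<noteq> 0"
    using q_power_neq_1[of n] q_power_neq_1[of "n + N"] by auto
  have "(1 - q ^ Suc n) * durfee N (Suc n) = q ^ (Suc n * Suc n + Suc n * N) / (qq n * qq (Suc (n + N)))"
    using nz unfolding durfee_def qq_Suc[of n] by (simp del: power_Suc)
  moreover have "q ^ n * durfee N n = q ^ n * q ^ (n * n + n * N) * (1 - q ^ Suc (n + N)) / (qq n * qq (Suc (n + N)))"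
    using nz unfolding durfee_def qq_Suc[of "n + N"] by (simp del: power_Suc)
  moreover have "q ^ n * q ^ (n * n + n * N) * (1 - q ^ Suc (n + N)) + q ^ (Suc n * Suc n + Suc n * N)
      = q ^ (n * n + n * Suc N)"
    by (simp add: power_add algebra_simps)
  ultimately have "q ^ n * durfee N n + (1 - q ^ Suc n) * durfee N (Suc n)
      = q ^ (n * n + n * Suc N) / (qq n * qq (Suc (n + N)))"
    by (simp only: add_divide_distrib[symmetric])
  then show ?thesis by (simp add: durfee_def)
qed

lemma durfee_bound:
  obtains K where "K > 0" "\<And>N n. norm (durfee N n) \<le> K * norm q ^ (n + n * N)"
proof -
  obtain K where K: "K > 0" "\<And>n. norm (1 / qq n) \<le> K" by (rule qq_inverse_bound) auto
  have "norm (durfee N n) \<le> (K * K) * norm q ^ (n + n * N)" for N n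
  proof -
    have "norm (durfee N n) = norm (1 / qq n) * norm (1 / qq (n + N)) * norm q ^ (n * n + n * N)"
      by (simp add: durfee_def norm_mult norm_divide norm_power)
    also have "\<dots> \<le> (K * K) * norm q ^ (n + n * N)"
      using K q1 by (intro mult_mono power_decreasing) auto
    finally show ?thesis .
  qed
  with K show ?thesis by (intro that[of "K * K"]) auto
qed

lemma summable_durfee: "summable (\<lambda>n. norm (durfee N n))"
proof -
  obtain K where K: "K > 0" "\<And>N n. norm (durfee N n) \<le> K * norm q ^ (n + n * N)"
    by (rule durfee_bound) auto
  show ?thesis
  proof (rule summable_comparison_test')
    show "summable (\<lambda>n. K * norm q ^ n)"
      using q1 by (intro summable_mult summable_geometric) simp
    fix n
    have "norm (durfee N n) \<le> K * norm q ^ (n + n * N)" by (rule K)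
    also have "\<dots> \<le> K * norm q ^ n"
      using q1 K by (intro mult_left_mono power_decreasing) auto
    finally show "norm (norm (durfee N n)) \<le> K * norm q ^ n" by simp
  qed
qed

lemma durfee_tail_tendsto: "(\<lambda>N. \<Sum>n. durfee N (Suc n)) \<longlonglongrightarrow> 0"
proof -
  obtain K where K: "K > 0" "\<And>N n. norm (durfee N n) \<le> K * norm q ^ (n + n * N)"
    by (rule durfee_bound) auto
  have geo: "summable (\<lambda>n. K * norm q ^ N * norm q ^ n)" for N
    using q1 by (intro summable_mult summable_geometric) simp
  have b2: "norm (\<Sum>n. durfee N (Suc n)) \<le> K * norm q ^ N * (1 / (1 - norm q))" for N
  proof -
    have b: "norm (durfee N (Suc n)) \<le> K * norm q ^ N * norm q ^ n" for n
    proof -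
      have "norm (durfee N (Suc n)) \<le> K * norm q ^ (Suc n + Suc n * N)" by (rule K)
      also have "\<dots> \<le> K * norm q ^ (N + n)"
        using q1 K by (intro mult_left_mono power_decreasing) auto
      finally show ?thesis by (simp add: power_add mult_ac)
    qed
    have "norm (\<Sum>n. durfee N (Suc n)) \<le> (\<Sum>n. K * norm q ^ N * norm q ^ n)"
      by (rule norm_suminf_le[OF b geo])
    also have "\<dots> = K * norm q ^ N * (1 / (1 - norm q))"
      using q1 by (subst suminf_mult) (auto simp: suminf_geometric intro!: summable_geometric)
    finally show ?thesis .
  qed
  have "(\<lambda>N. K * norm q ^ N * (1 / (1 - norm q))) \<longlonglongrightarrow> K * 0 * (1 / (1 - norm q))"
    using q1 by (intro tendsto_intros LIMSEQ_power_zero) simp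
  then have "(\<lambda>N. K * norm q ^ N * (1 / (1 - norm q))) \<longlonglongrightarrow> 0" by simp
  then show ?thesis
    by (rule Lim_null_comparison[OF always_eventually[OF allI[OF b2]]])
qed

text \<open>The sum is independent of \<open>N\<close>, and for \<open>N \<rightarrow> \<infinity>\<close> only the summand \<open>n = 0\<close> survives.\<close>

lemma suminf_durfee: "(\<Sum>n. durfee N n) = 1 / qpoch_inf q q"
proof -
  define C where "C N = (\<Sum>n. durfee N n)" for N
  have sm: "summable (durfee N)" for N
    by (rule summable_norm_cancel[OF summable_durfee])
  have const: "C (Suc N) = C N" for N
  proof -
    define g where "g n = (1 - q ^ n) * durfee N n" for n
    have g0: "g \<longlonglongrightarrow> (1 - 0) * 0"
      unfolding g_def using q1
      by (intro tendsto_intros LIMSEQ_power_zero summable_LIMSEQ_zero[OF sm]) simp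
    have "(\<lambda>n. durfee N n - durfee (Suc N) n) sums (C N - C (Suc N))"
      unfolding C_def by (intro sums_diff summable_sums sm)
    moreover have "(\<lambda>n. durfee N n - durfee (Suc N) n) = (\<lambda>n. g n - g (Suc n))"
      unfolding g_def durfee_step by (simp add: algebra_simps)
    moreover have "(\<lambda>n. g n - g (Suc n)) sums (g 0 - 0)"
      using g0 by (intro telescope_sums') simp
    ultimately have "C N - C (Suc N) = g 0"
      by (simp add: sums_iff)
    then show ?thesis by (simp add: g_def)
  qed
  then have CN: "C N = C 0" for N by (induction N) simp_all
  have "C N = 1 / qq N + (\<Sum>n. durfee N (Suc n))" for N
    unfolding C_def using suminf_split_head[OF sm, of N] by (simp add: durfee_def)
  moreover have "(\<lambda>N. 1 / qq N + (\<Sum>n. durfee N (Suc n))) \<longlonglongrightarrow> 1 / qpoch_inf q q + 0"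
    by (intro tendsto_intros qpoch_tendsto durfee_tail_tendsto) simp
  ultimately have "(\<lambda>N. C N) \<longlonglongrightarrow> 1 / qpoch_inf q q" by simp
  moreover have "(\<lambda>N. C N) \<longlonglongrightarrow> C 0"
    by (rule tendsto_eventually) (rule always_eventually, rule allI, rule CN)
  ultimately have "1 / qpoch_inf q q = C 0" by (rule LIMSEQ_unique)
  then have "C N = 1 / qpoch_inf q q" by (rule trans[OF CN sym])
  then show ?thesis by (simp only: C_def)
qed

lemma has_sum_durfee: "(durfee N has_sum 1 / qpoch_inf q q) UNIV"
  using norm_summable_imp_has_sum[OF summable_durfee
      summable_sums[OF summable_norm_cancel[OF summable_durfee]]]
  by (simp add: suminf_durfee)

definition theta :: "complex \<Rightarrow> complex" where
  "theta x = qpoch_inf x q * qpoch_inf (q / x) q"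

lemma tau_square: "tau (int m) * tau (int m) * q ^ m = q ^ (m * m)"
proof (induction m)
  case (Suc m)
  have "tau (int (Suc m)) * tau (int (Suc m)) * q ^ Suc m
      = (tau (int m) * tau (int m) * q ^ m) * (q ^ m * q ^ m * q)"
    unfolding tau_Suc by (simp add: algebra_simps)
  also have "\<dots> = q ^ (Suc m * Suc m)"
    unfolding Suc.IH by (simp add: power_add algebra_simps)
  finally show ?case .
qed simp

text \<open>The contribution of \<open>(m + M, m)\<close> to the product of the Euler series of \<open>(x;q)\<^sub>\<infinity>\<close> and \<open>(q/x;q)\<^sub>\<infinity>\<close>.\<close>

lemma euler_coeff_durfee:
  "euler_coeff (m + M) * euler_coeff m * q ^ m = tau (int M) * durfee M m"
proof -
  have "euler_coeff (m + M) * euler_coeff m * q ^ m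
      = tau (int M) * (tau (int m) * tau (int m) * q ^ m) * q ^ (m * M) / (qq m * qq (m + M))"
    unfolding euler_coeff_def of_nat_add tau_add
    by (simp add: field_simps flip: of_nat_mult)
  then show ?thesis
    unfolding tau_square durfee_def by (simp add: power_add)
qed

text \<open>The Jacobi triple product. Multiply the Euler series of both factors and collect the power \<open>x\<^sup>N\<close>: the
  pairs of indices with difference \<open>N\<close> give exactly the sum in Cauchy's identity.\<close>

lemma has_sum_theta:
  assumes x: "x \<noteq> 0"
  shows "((\<lambda>N. tau N * x powi N) has_sum (qpoch_inf q q * theta x)) UNIV"
proof -
  define h where "h = (\<lambda>(i, j). euler_coeff i * x ^ i * (euler_coeff j * (q / x) ^ j))"
  have h: "(h has_sum theta x) (UNIV \<times> UNIV)"
    unfolding h_def theta_def by (intro has_sum_complex_product has_sum_euler)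
  \<comment> \<open>An index pair is determined by its difference \<open>N\<close> and its minimum \<open>m\<close>.\<close>
  let ?i = "\<lambda>(N, m). (m + nat N, m + nat (- N))"
  have "((\<lambda>p. h (?i p)) has_sum theta x) (UNIV \<times> UNIV) \<longleftrightarrow> (h has_sum theta x) (UNIV \<times> UNIV)"
    by (rule has_sum_reindex_bij_witness[where i = "\<lambda>(i, j). (int i - int j, min i j)" and j = ?i]) auto
  with h have h': "((\<lambda>p. h (?i p)) has_sum theta x) (UNIV \<times> UNIV)" by blast
  have "((\<lambda>m. h (?i (N, m))) has_sum tau N * x powi N * (1 / qpoch_inf q q)) UNIV" for N
  proof -
    have "h (?i (N, m)) = tau N * x powi N * durfee (nat \<bar>N\<bar>) m" for m
    proof (cases "N \<ge> 0")
      case True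
      then obtain M where M: "N = int M" using nonneg_int_cases by blast
      have "h (?i (N, m)) = (euler_coeff (m + M) * euler_coeff m * q ^ m) * x ^ M"
        using x by (simp add: h_def M power_add power_divide)
      then show ?thesis
        by (simp only: euler_coeff_durfee) (simp add: M)
    next
      case False
      then obtain M where M: "N = - int M" by (cases N rule: int_cases2) auto
      have "h (?i (N, m)) = (euler_coeff (m + M) * euler_coeff m * q ^ m) * q ^ M / x ^ M"
        using x by (simp add: h_def M power_add power_divide)
      also have "\<dots> = tau N * x powi N * durfee (nat \<bar>N\<bar>) m"
        unfolding euler_coeff_durfee M tau_uminus by (simp add: power_int_minus divide_inverse)
      finally show ?thesis .
    qed
    then show ?thesis using has_sum_cmult_right[OF has_sum_durfee] by simp
  qed
  then have "((\<lambda>N. tau N * x powi N * (1 / qpoch_inf q q)) has_sum theta x) UNIV"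
    using has_sum_SigmaD[OF h', of "\<lambda>N. tau N * x powi N * (1 / qpoch_inf q q)"] by simp
  from has_sum_cmult_right[OF this, of "qpoch_inf q q"] show ?thesis by simp
qed

section \<open>The double Euler series and its theta products\<close>

text \<open>The finite \<open>q\<close>-binomial theorem. Splitting \<open>1 - q\<^bsup>m+1\<^esup> = (1 - q\<^bsup>m+1-j\<^esup>) + q\<^bsup>m+1-j\<^esup>(1 - q\<^sup>j)\<close> in each summand
  reproduces the sum for \<open>m\<close> twice, with the factors \<open>1\<close> and \<open>-aq\<^sup>m\<close>.\<close>

lemma finite_binomial:
  "(\<Sum>j\<le>m. euler_coeff j * a ^ j / qq (m - j)) = qpoch a q m / qq m"
proof (induction m)
  case (Suc m)
  define S where "S = (\<Sum>j\<le>m. euler_coeff j * a ^ j / qq (m - j))"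
  have nz: "1 - q ^ Suc n \<noteq> 0" for n
    using q_power_neq_1[of n] by auto
  have "(1 - q ^ Suc m) * (\<Sum>j\<le>Suc m. euler_coeff j * a ^ j / qq (Suc m - j))
      = (\<Sum>j\<le>Suc m. euler_coeff j * a ^ j * (1 - q ^ (Suc m - j)) / qq (Suc m - j))
        + (\<Sum>j\<le>Suc m. euler_coeff j * (1 - q ^ j) * a ^ j * q ^ (Suc m - j) / qq (Suc m - j))"
    unfolding sum_distrib_left sum.distrib[symmetric]
  proof (rule sum.cong[OF refl])
    fix j assume "j \<in> {..Suc m}"
    then have "q ^ Suc m = q ^ (Suc m - j) * q ^ j" by (simp flip: power_add)
    then show "(1 - q ^ Suc m) * (euler_coeff j * a ^ j / qq (Suc m - j)) =
        euler_coeff j * a ^ j * (1 - q ^ (Suc m - j)) / qq (Suc m - j) +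
        euler_coeff j * (1 - q ^ j) * a ^ j * q ^ (Suc m - j) / qq (Suc m - j)"
      by (simp add: field_simps del: power_Suc)
  qed
  also have "(\<Sum>j\<le>Suc m. euler_coeff j * a ^ j * (1 - q ^ (Suc m - j)) / qq (Suc m - j)) = S"
    unfolding S_def
  proof (subst sum.atMost_Suc, simp, rule sum.cong[OF refl])
    fix j assume "j \<in> {..m}"
    then show "euler_coeff j * a ^ j * (1 - q ^ (Suc m - j)) / qq (Suc m - j) = euler_coeff j * a ^ j / qq (m - j)"
      using nz[of "m - j"] by (simp add: Suc_diff_le qq_Suc del: power_Suc)
  qed
  also have "(\<Sum>j\<le>Suc m. euler_coeff j * (1 - q ^ j) * a ^ j * q ^ (Suc m - j) / qq (Suc m - j))
      = - a * q ^ m * S"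
  proof -
    let ?F = "\<lambda>j. euler_coeff j * (1 - q ^ j) * a ^ j * q ^ (Suc m - j) / qq (Suc m - j)"
    have "(\<Sum>j\<le>Suc m. ?F j) = (\<Sum>j\<le>m. ?F (Suc j))"
      by (subst sum.atMost_Suc_shift) simp
    also have "\<dots> = (\<Sum>j\<le>m. - a * q ^ m * (euler_coeff j * a ^ j / qq (m - j)))"
    proof (rule sum.cong[OF refl])
      fix j assume "j \<in> {..m}"
      then have "q ^ m = q ^ (m - j) * q ^ j" by (simp flip: power_add)
      then show "?F (Suc j) = - a * q ^ m * (euler_coeff j * a ^ j / qq (m - j))"
        unfolding euler_coeff_Suc diff_Suc_Suc by (simp add: mult_ac)
    qed
    finally show ?thesis by (simp only: S_def sum_distrib_left)
  qed
  finally have "(1 - q ^ Suc m) * (\<Sum>j\<le>Suc m. euler_coeff j * a ^ j / qq (Suc m - j)) = (1 - a * q ^ m) * S"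
    by (simp add: algebra_simps)
  moreover have "S = qpoch a q m / qq m" using Suc.IH by (simp add: S_def)
  ultimately have "(1 - q ^ Suc m) * (\<Sum>j\<le>Suc m. euler_coeff j * a ^ j / qq (Suc m - j))
      = (1 - q ^ Suc m) * (qpoch a q (Suc m) / qq (Suc m))"
    using nz[of m] by (simp add: qpoch_Suc[of a] qq_Suc mult_ac del: power_Suc sum.atMost_Suc)
  then show ?case by (rule mult_left_cancel[OF nz[of m], THEN iffD1])
qed simp

text \<open>Expanding the infinite product by Euler's series shows this to be a series in \<open>\<alpha>\<close> and \<open>\<beta>\<close> that is symmetric and
  whose Gaussian factor depends only on the total degree; the form with one sum is the one in which it occurs.\<close>

definition double_euler :: "complex \<Rightarrow> complex \<Rightarrow> complex" where
  "double_euler \<alpha> \<beta> = (\<Sum>\<^sub>\<infinity>i. euler_coeff i * (q * \<alpha>) ^ i * qpoch_inf (q ^ Suc i * \<beta>) q)"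

lemma has_sum_double_euler_expanded:
    "((\<lambda>(i, j). euler_coeff i * (q * \<alpha>) ^ i * (euler_coeff j * (q * \<beta>) ^ j) * q ^ (i * j))
        has_sum double_euler \<alpha> \<beta>) (UNIV \<times> UNIV)" (is "(?f has_sum _) _")
  and has_sum_double_euler: "((\<lambda>i. euler_coeff i * (q * \<alpha>) ^ i * qpoch_inf (q ^ Suc i * \<beta>) q) has_sum double_euler \<alpha> \<beta>) UNIV"
proof -
  have inner: "((\<lambda>j. ?f (i, j)) has_sum euler_coeff i * (q * \<alpha>) ^ i * qpoch_inf (q ^ Suc i * \<beta>) q) UNIV" for i
    using has_sum_cmult_right[OF has_sum_euler[of "q ^ Suc i * \<beta>"], of "euler_coeff i * (q * \<alpha>) ^ i"]
    by (simp add: power_mult_distrib mult_ac flip: power_mult)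
  have "(\<lambda>(i, j). euler_coeff i * (q * \<alpha>) ^ i * (euler_coeff j * (q * \<beta>) ^ j)) summable_on (UNIV \<times> UNIV)"
    using has_sum_complex_product[OF has_sum_euler[of "q * \<alpha>"] has_sum_euler[of "q * \<beta>"]]
    by (auto simp: summable_on_def)
  then have "(\<lambda>p. norm ((\<lambda>(i, j). euler_coeff i * (q * \<alpha>) ^ i * (euler_coeff j * (q * \<beta>) ^ j)) p)) summable_on (UNIV \<times> UNIV)"
    by (simp only: summable_on_iff_abs_summable_on_complex)
  then have "(\<lambda>p. norm (?f p)) summable_on (UNIV \<times> UNIV)"
  proof (rule Infinite_Sum.abs_summable_on_comparison_test)
    fix p :: "nat \<times> nat"
    obtain i j where p: "p = (i, j)" by (cases p)
    have "norm q ^ (i * j) \<le> 1" using q1 by (intro power_le_one) auto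
    then show "norm (?f p) \<le> norm ((\<lambda>(i, j). euler_coeff i * (q * \<alpha>) ^ i * (euler_coeff j * (q * \<beta>) ^ j)) p)"
      by (simp add: p norm_mult norm_power mult_left_le)
  qed
  then have "?f summable_on (UNIV \<times> UNIV)" by (rule abs_summable_summable)
  then obtain S where S: "(?f has_sum S) (UNIV \<times> UNIV)" by (auto simp: summable_on_def)
  then have T: "((\<lambda>i. euler_coeff i * (q * \<alpha>) ^ i * qpoch_inf (q ^ Suc i * \<beta>) q) has_sum S) UNIV"
    by (rule has_sum_SigmaD) (rule inner)
  then have "S = double_euler \<alpha> \<beta>" unfolding double_euler_def by (simp add: infsumI)
  with S T show "(?f has_sum double_euler \<alpha> \<beta>) (UNIV \<times> UNIV)"
    "((\<lambda>i. euler_coeff i * (q * \<alpha>) ^ i * qpoch_inf (q ^ Suc i * \<beta>) q) has_sum double_euler \<alpha> \<beta>) UNIV" by simp_all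
qed

text \<open>For \<open>a \<ge> 0\<close> this is \<open>(-1)\<^bsup>a+b\<^esup> q\<^bsup>a(a+1)/2 + b(b-1)/2\<^esup> (q\<^sup>b;q)\<^sub>a / (q;q)\<^sub>a\<close>. The value zero for
  \<open>a < 0\<close> is the convention \<open>1 / (q;q)\<^sub>a = 0\<close>; it lets all Laurent series below run over all pairs of integers.\<close>

definition laurent_coeff :: "int \<Rightarrow> int \<Rightarrow> complex" where
  "laurent_coeff a b = (if a < 0 then 0
     else tau a * q powi a * tau b * (qpoch (q powi b) q (nat a) / qq (nat a)))"

text \<open>The second argument \<open>\<alpha>/y\<close> is chosen so that a factor \<open>\<beta>\<^sup>j y\<^sup>N\<close> becomes \<open>\<alpha>\<^sup>j y\<^bsup>N-j\<^esup>\<close>. Collecting the total degree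
  \<open>a\<close> in \<open>\<alpha>\<close> and the exponent \<open>b\<close> of \<open>y\<close> leaves a finite sum, which the finite \<open>q\<close>-binomial theorem
  evaluates.\<close>

lemma has_sum_theta_double_euler:
  assumes "\<alpha> \<noteq> 0" "y \<noteq> 0"
  shows "((\<lambda>(a, b). laurent_coeff a b * \<alpha> powi a * y powi b)
     has_sum (qpoch_inf q q * theta y * double_euler \<alpha> (\<alpha> / y))) (UNIV \<times> UNIV)"
proof -
  define \<beta> where "\<beta> = \<alpha> / y"
  define f where "f = (\<lambda>(i, j). euler_coeff i * (q * \<alpha>) ^ i * (euler_coeff j * (q * \<beta>) ^ j) * q ^ (i * j))"
  define g where "g = (\<lambda>(p, N). f p * (tau N * y powi N))"
  let ?V = "double_euler \<alpha> \<beta> * (qpoch_inf q q * theta y)"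
  have g: "(g has_sum ?V) ((UNIV \<times> UNIV) \<times> UNIV)"
    unfolding g_def f_def
    by (rule has_sum_complex_product[OF has_sum_double_euler_expanded has_sum_theta[OF assms(2)]])
  let ?S = "SIGMA ab:UNIV \<times> UNIV. {..fst ab}"
  let ?j = "\<lambda>((a, b), j). ((a - j, j), b + int j)"
  have "((\<lambda>p. g (?j p)) has_sum ?V) ?S \<longleftrightarrow> (g has_sum ?V) ((UNIV \<times> UNIV) \<times> UNIV)"
    by (rule has_sum_reindex_bij_witness[where j = ?j and i = "\<lambda>((i, j), N). ((i + j, N - int j), j)"]) auto
  with g have g': "((\<lambda>p. g (?j p)) has_sum ?V) ?S" by blast
  define h where "h = (\<lambda>(a :: nat, b). laurent_coeff (int a) b * \<alpha> ^ a * y powi b)"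
  have "((\<lambda>j. g (?j (ab, j))) has_sum h ab) {..fst ab}" for ab
  proof -
    obtain a b where ab: "ab = (a, b)" by (cases ab)
    have "g (?j (ab, j)) = (tau (int a) * q ^ a * tau b * \<alpha> ^ a * y powi b)
        * (euler_coeff j * (q powi b) ^ j / qq (a - j))" if "j \<le> a" for j
    proof -
      have 1: "tau (int a) = tau (int (a - j)) * tau (int j) * q ^ ((a - j) * j)"
        using tau_add[of "int (a - j)" "int j"]
        by (simp only: of_nat_mult[symmetric] of_nat_add[symmetric] power_int_of_nat le_add_diff_inverse2[OF that])
      have 2: "tau (b + int j) = tau b * tau (int j) * (q powi b) ^ j"
        by (simp add: tau_add power_int_mult)
      have 3: "y powi (b + int j) = y powi b * y ^ j"
        using assms by (simp add: power_int_add)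
      have 4: "q ^ a = q ^ (a - j) * q ^ j" "\<alpha> ^ a = \<alpha> ^ (a - j) * \<alpha> ^ j"
        using that by (simp_all flip: power_add)
      have 5: "\<beta> ^ j * y ^ j = \<alpha> ^ j"
        using assms by (simp add: \<beta>_def flip: power_mult_distrib)
      have "g (?j (ab, j)) = tau (int (a - j)) * tau (int j) * q ^ ((a - j) * j) * (q ^ (a - j) * q ^ j)
          * (\<alpha> ^ (a - j) * (\<beta> ^ j * y ^ j)) * (tau b * tau (int j) * (q powi b) ^ j) * y powi b / (qq j * qq (a - j))"
        by (simp add: ab g_def f_def 2 3 euler_coeff_def power_mult_distrib field_simps)
      also have "\<dots> = tau (int a) * q ^ a * \<alpha> ^ a * (tau b * tau (int j) * (q powi b) ^ j) * y powi b / (qq j * qq (a - j))"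
        by (simp only: 1[symmetric] 4[symmetric] 5)
      finally show ?thesis by (simp add: euler_coeff_def field_simps)
    qed
    then have "(\<Sum>j\<le>a. g (?j (ab, j))) = (tau (int a) * q ^ a * tau b * \<alpha> ^ a * y powi b)
        * (\<Sum>j\<le>a. euler_coeff j * (q powi b) ^ j / qq (a - j))"
      by (simp add: sum_distrib_left)
    also have "\<dots> = h ab"
      unfolding finite_binomial by (simp add: ab h_def laurent_coeff_def)
    finally show ?thesis using has_sum_finite[of "{..a}" "\<lambda>j. g (?j (ab, j))"] by (simp add: ab)
  qed
  then have "(h has_sum ?V) (UNIV \<times> UNIV)"
    using has_sum_SigmaD[OF g', of h] by simp
  moreover have "(h has_sum ?V) (UNIV \<times> UNIV) \<longleftrightarrow>
      ((\<lambda>(a, b). laurent_coeff a b * \<alpha> powi a * y powi b) has_sum ?V) ({0..} \<times> UNIV)"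
    by (rule has_sum_reindex_bij_witness[where j = "\<lambda>(a, b). (int a, b)" and i = "\<lambda>(a, b). (nat a, b)"])
       (auto simp: h_def)
  moreover have "((\<lambda>(a, b). laurent_coeff a b * \<alpha> powi a * y powi b) has_sum ?V) ({0..} \<times> UNIV)
      \<longleftrightarrow> ((\<lambda>(a, b). laurent_coeff a b * \<alpha> powi a * y powi b) has_sum ?V) (UNIV \<times> UNIV)"
    by (rule has_sum_cong_neutral) (auto simp: laurent_coeff_def split: if_splits)
  ultimately show ?thesis by (simp add: \<beta>_def mult_ac)
qed

text \<open>In this range the coefficient is symmetric in \<open>a\<close> and \<open>m\<close>.\<close>

lemma laurent_coeff_pos:
  "laurent_coeff (int a) (int m + 1) = - (tau (int a) * tau (int m) * q ^ (a + m) * qq (a + m) / (qq a * qq m))"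
proof -
  have "qq (m + a) = qq m * qpoch (q * q ^ m) q a" by (rule qpoch_add)
  then have "qpoch (q powi (int m + 1)) q a = qq (a + m) / qq m"
    using q0 by (simp add: power_int_add mult_ac add.commute)
  moreover have "tau (int m + 1) = - (tau (int m) * q ^ m)"
    by (simp add: tau_add)
  ultimately show ?thesis
    by (simp add: laurent_coeff_def power_add mult_ac)
qed

lemma qpoch_neg_power:
  "a \<le> B \<Longrightarrow> qpoch (q powi (- int B)) q a = tau (int a) * q powi (- int (B * a)) * qq B / qq (B - a)"
proof (induction a)
  case (Suc a)
  define d where "d = B - Suc a"
  have B: "B = Suc (a + d)" using Suc.prems by (simp add: d_def)
  have nz: "1 - q ^ Suc d \<noteq> 0" using q_power_neq_1[of d] by auto
  have e: "q powi (- int B) * q ^ a = inverse (q ^ Suc d)"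
  proof -
    have "q powi (- int B) = inverse (q ^ Suc (a + d))"
      by (simp only: B power_int_minus power_int_of_nat)
    then show ?thesis using q0 by (simp add: power_add field_simps)
  qed
  have "1 - q powi (- int B) * q ^ a = - (q powi (- int B) * q ^ a) * (1 - q ^ Suc d)"
    unfolding e using q0 by (simp add: field_simps)
  then have "qpoch (q powi (- int B)) q (Suc a) =
      tau (int a) * q powi (- int (B * a)) * qq B / qq (Suc d) * (- (q powi (- int B) * q ^ a) * (1 - q ^ Suc d))"
    using Suc B by (simp add: qpoch_Suc[of _ q a])
  also have "\<dots> = - (tau (int a) * q ^ a) * (q powi (- int (B * a)) * q powi (- int B)) * qq B / qq d"
    using nz by (simp add: qq_Suc del: power_Suc)
  also have "q powi (- int (B * a)) * q powi (- int B) = q powi (- int (B * Suc a))"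
    using q0 by (subst power_int_add[symmetric]) (auto simp: algebra_simps)
  finally show ?case by (simp only: tau_Suc d_def)
qed simp

text \<open>In this range the coefficient is invariant under \<open>a \<mapsto> B - a\<close>.\<close>

lemma laurent_coeff_neg:
  assumes "a \<le> B"
  shows "laurent_coeff (int a) (- int B)
     = q powi (int a * (int a - int B)) * tau (- int B) * qq B / (qq a * qq (B - a))"
proof -
  have "laurent_coeff (int a) (- int B) = (tau (int a) * tau (int a) * q ^ a) * q powi (- int (B * a))
      * tau (- int B) * qq B / (qq a * qq (B - a))"
    by (simp add: laurent_coeff_def qpoch_neg_power[OF assms] field_simps)
  also have "(tau (int a) * tau (int a) * q ^ a) * q powi (- int (B * a)) = q powi (int a * (int a - int B))"
  proof -
    have "q ^ (a * a) * q powi (- int (B * a)) = q powi (int (a * a) + - int (B * a))"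
      using q0 by (subst power_int_add) (auto simp flip: power_int_of_nat)
    then show ?thesis unfolding tau_square by (simp add: algebra_simps)
  qed
  finally show ?thesis .
qed

lemma laurent_coeff_zero: "B < a \<Longrightarrow> laurent_coeff (int a) (- int B) = 0"
proof -
  assume "B < a"
  then have "qpoch (q powi (- int B)) q a = 0"
    using q0 by (intro qpoch_eq_0I[of _ _ B]) (auto simp: power_int_minus)
  then show ?thesis by (simp add: laurent_coeff_def)
qed

text \<open>At least one of the three coefficients vanishes in each region of the plane of indices, and the other two
  agree up to sign, by one of the symmetries of \<open>laurent_coeff_pos\<close> and \<open>laurent_coeff_neg\<close>, or by comparing these two
  formulas when \<open>a < 0 < b\<close>.\<close>

lemma laurent_coeff_relation:
  "laurent_coeff a b - laurent_coeff (b - 1) (a + 1) = laurent_coeff (- a - b) b"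
proof (cases "b \<le> 0")
  case True
  then obtain B where B: "b = - int B" by (cases b rule: int_cases2) auto
  have z: "laurent_coeff (b - 1) (a + 1) = 0" using True by (simp add: laurent_coeff_def)
  consider "a < 0" | "a > int B" | "0 \<le> a" "a \<le> int B" by linarith
  then have "laurent_coeff a b = laurent_coeff (- a - b) b"
  proof cases
    case 1
    then have "- a - b = int (nat (- a) + B)" "B < nat (- a) + B" by (auto simp: B)
    with 1 show ?thesis using laurent_coeff_zero[of B "nat (- a) + B"]
      by (simp only: B) (simp add: laurent_coeff_def)
  next
    case 2
    then have "a = int (nat a)" "B < nat a" by auto
    with 2 show ?thesis using laurent_coeff_zero[of B "nat a"] by (simp add: B laurent_coeff_def)
  next
    case 3
    then obtain n where n: "a = int n" "n \<le> B" by (cases a rule: int_cases2) auto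
    have e: "- a - b = int (B - n)" using n by (simp add: B of_nat_diff)
    have "laurent_coeff (int (B - n)) (- int B) = laurent_coeff (int n) (- int B)"
    proof -
      have "int (B - n) * (int (B - n) - int B) = int n * (int n - int B)" "B - (B - n) = n"
        using n(2) by (auto simp: of_nat_diff algebra_simps)
      then show ?thesis
        unfolding laurent_coeff_neg[OF n(2)] laurent_coeff_neg[OF diff_le_self] by (simp only: mult_ac)
    qed
    then show ?thesis unfolding e by (simp add: n B)
  qed
  then show ?thesis using z by simp
next
  case False
  define m where "m = nat (b - 1)"
  have m: "b = int m + 1" using False by (simp add: m_def)
  show ?thesis
  proof (cases "a \<ge> 0")
    case True
    then obtain n where n: "a = int n" using nonneg_int_cases by blast
    have "laurent_coeff (int n) (int m + 1) = laurent_coeff (int m) (int n + 1)"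
      unfolding laurent_coeff_pos by (simp add: add.commute mult_ac)
    moreover have "laurent_coeff (- a - b) b = 0" by (simp add: laurent_coeff_def n m)
    ultimately show ?thesis by (simp add: n m)
  next
    case False
    define p where "p = nat (- 1 - a)"
    have p: "a = - 1 - int p" using False by (simp add: p_def)
    have z: "laurent_coeff a b = 0" using False by (simp add: laurent_coeff_def)
    show ?thesis
    proof (cases "p < m")
      case True
      then show ?thesis using z laurent_coeff_zero[OF True]
        by (simp add: p m) (simp add: laurent_coeff_def)
    next
      case False
      then obtain n where n: "p = m + n" using le_Suc_ex not_less by blast
      have "q powi (- (int m * int n)) * q ^ (m * n) = 1"
        using q0 by (simp add: power_int_minus flip: of_nat_mult)
      moreover have "tau (- int (m + n)) = tau (int m) * tau (int n) * q ^ (m * n) * q ^ (m + n)"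
        unfolding tau_uminus of_nat_add tau_add by (simp flip: of_nat_mult of_nat_add)
      ultimately have "laurent_coeff (int m) (- int (m + n))
          = tau (int m) * tau (int n) * q ^ (m + n) * qq (m + n) / (qq m * qq n)"
        using laurent_coeff_neg[of m "m + n"] by (simp add: mult_ac)
      then have "- laurent_coeff (int m) (- int (m + n)) = laurent_coeff (int n) (int m + 1)"
        unfolding laurent_coeff_pos by (simp add: add.commute mult_ac)
      then show ?thesis using z by (simp add: p m n)
    qed
  qed
qed

text \<open>Each of the three products is a Laurent series in \<open>X\<close> and \<open>Y\<close> by \<open>has_sum_theta_double_euler\<close>; after a
  linear substitution of the indices, \<open>laurent_coeff_relation\<close> compares the coefficients.\<close>

theorem theta_three_term:
  assumes X: "X \<noteq> 0" and Y: "Y \<noteq> 0"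
  shows "theta Y * double_euler X (X / Y) - Y / X * (theta X * double_euler Y (Y / X))
       = theta (Y / X) * double_euler (1 / X) (1 / Y)"
proof -
  let ?Q = "qpoch_inf q q"
  have 1: "((\<lambda>(a, b). laurent_coeff a b * X powi a * Y powi b)
      has_sum (?Q * theta Y * double_euler X (X / Y))) (UNIV \<times> UNIV)"
    by (rule has_sum_theta_double_euler[OF X Y])
  have "((\<lambda>(a, b). laurent_coeff (b - 1) (a + 1) * X powi a * Y powi b)
      has_sum (Y / X * (?Q * theta X * double_euler Y (Y / X)))) (UNIV \<times> UNIV) \<longleftrightarrow>
     ((\<lambda>p. Y / X * (\<lambda>(a, b). laurent_coeff a b * Y powi a * X powi b) p)
      has_sum (Y / X * (?Q * theta X * double_euler Y (Y / X)))) (UNIV \<times> UNIV)"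
    by (rule has_sum_reindex_bij_witness[where j = "\<lambda>(a, b). (b - 1, a + 1)" and i = "\<lambda>(a, b). (b - 1, a + 1)"])
       (use X Y in \<open>auto simp: power_int_add power_int_diff\<close>)
  then have 2: "((\<lambda>(a, b). laurent_coeff (b - 1) (a + 1) * X powi a * Y powi b)
      has_sum (Y / X * (?Q * theta X * double_euler Y (Y / X)))) (UNIV \<times> UNIV)"
    using has_sum_cmult_right[OF has_sum_theta_double_euler[OF Y X]] by blast
  have "((\<lambda>(a, b). laurent_coeff (- a - b) b * X powi a * Y powi b)
      has_sum (?Q * theta (Y / X) * double_euler (1 / X) (1 / X / (Y / X)))) (UNIV \<times> UNIV) \<longleftrightarrow>
     ((\<lambda>(a, b). laurent_coeff a b * (1 / X) powi a * (Y / X) powi b)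
      has_sum (?Q * theta (Y / X) * double_euler (1 / X) (1 / X / (Y / X)))) (UNIV \<times> UNIV)"
    by (rule has_sum_reindex_bij_witness[where j = "\<lambda>(a, b). (- a - b, b)" and i = "\<lambda>(a, b). (- a - b, b)"])
       (use X Y in \<open>auto simp: power_int_diff power_int_divide_distrib power_int_minus divide_simps\<close>)
  then have 3: "((\<lambda>(a, b). laurent_coeff (- a - b) b * X powi a * Y powi b)
      has_sum (?Q * theta (Y / X) * double_euler (1 / X) (1 / X / (Y / X)))) (UNIV \<times> UNIV)"
    using has_sum_theta_double_euler[of "1 / X" "Y / X"] X Y by simp
  have "((\<lambda>(a, b). laurent_coeff (- a - b) b * X powi a * Y powi b)
      has_sum (?Q * theta Y * double_euler X (X / Y) - Y / X * (?Q * theta X * double_euler Y (Y / X)))) (UNIV \<times> UNIV)"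
    using has_sum_add[OF 1 has_sum_uminusI[OF 2]] unfolding laurent_coeff_relation[symmetric]
    by (simp add: case_prod_unfold algebra_simps)
  from has_sum_unique[OF this 3] have
    "?Q * (theta Y * double_euler X (X / Y) - Y / X * (theta X * double_euler Y (Y / X)))
       = ?Q * (theta (Y / X) * double_euler (1 / X) (1 / X / (Y / X)))"
    by (simp add: algebra_simps)
  moreover have "1 / X / (Y / X) = 1 / Y" using X by simp
  ultimately show ?thesis using X by simp
qed

end

section \<open>The connection formula\<close>

lemma summable_linear_recurrence:
  fixes u s :: "nat \<Rightarrow> real"
  assumes u: "\<And>n. u n \<ge> 0" and r: "0 \<le> r" "r < 1" and s: "summable s" "\<And>n. s n \<ge> 0"
    and rec: "\<And>n. u (Suc n) = r * u n + s n"
  shows "summable u"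
proof (rule bounded_imp_summable[OF u])
  fix n
  have "(\<Sum>k\<le>n. u k) \<le> (\<Sum>k\<le>Suc n. u k)" using u by simp
  also have "\<dots> = u 0 + (\<Sum>k\<le>n. u (Suc k))" by (rule sum.atMost_Suc_shift)
  also have "\<dots> = u 0 + r * (\<Sum>k\<le>n. u k) + (\<Sum>k\<le>n. s k)"
    by (simp add: rec sum.distrib sum_distrib_left)
  also have "(\<Sum>k\<le>n. s k) \<le> suminf s" by (rule sum_le_suminf) (use s in auto)
  finally have "(1 - r) * (\<Sum>k\<le>n. u k) \<le> u 0 + suminf s" by (simp add: algebra_simps)
  then show "(\<Sum>k\<le>n. u k) \<le> (u 0 + suminf s) / (1 - r)"
    using r by (simp add: field_simps)
qed

context qbase begin

text \<open>A partial theta function with positive terms; up to a constant it bounds Euler's series at arguments that grow like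
  \<open>1/q\<^sup>n\<close>.\<close>

definition gauss_sum :: "real \<Rightarrow> real" where
  "gauss_sum y = (\<Sum>l. norm (tau (int l)) * y ^ l)"

lemma summable_gauss: "summable (\<lambda>l. norm (tau (int l)) * y ^ l)"
  using summable_tau[of "of_real y"]
  by (intro summable_norm_cancel[where f = "\<lambda>l. norm (tau (int l)) * y ^ l"])
     (simp add: norm_mult norm_power abs_mult power_abs)

lemma gauss_sum_nonneg: "y \<ge> 0 \<Longrightarrow> gauss_sum y \<ge> 0"
  unfolding gauss_sum_def by (intro suminf_nonneg summable_gauss) auto

lemma gauss_sum_step: "gauss_sum y = 1 + y * gauss_sum (norm q * y)"
proof -
  have "gauss_sum y = 1 + (\<Sum>l. norm (tau (int (Suc l))) * y ^ Suc l)"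
    unfolding gauss_sum_def using suminf_split_head[OF summable_gauss, of y] by simp
  also have "(\<lambda>l. norm (tau (int (Suc l))) * y ^ Suc l) = (\<lambda>l. y * (norm (tau (int l)) * (norm q * y) ^ l))"
    by (rule ext) (simp only: tau_Suc, simp add: norm_mult norm_power power_mult_distrib)
  also have "(\<Sum>l. y * (norm (tau (int l)) * (norm q * y) ^ l)) = y * gauss_sum (norm q * y)"
    unfolding gauss_sum_def by (rule suminf_mult[OF summable_gauss])
  finally show ?thesis .
qed

text \<open>The factor \<open>gauss_sum (y / \<bar>q\<bar>\<^sup>n)\<close> grows as fast as the Gaussian factor decays, so convergence is only
  geometric. The functional equation of \<open>gauss_sum\<close> says that the terms satisfy a first-order linear recurrence with factor
  \<open>xy < 1\<close> and a summable inhomogeneity.\<close>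

lemma summable_gauss_sum:
  assumes x: "x > 0" and y: "y \<ge> 0" and xy: "x * y < 1"
  shows "summable (\<lambda>n. norm (tau (int n)) * (norm q * x) ^ n * gauss_sum (y / norm q ^ n))"
proof (rule summable_linear_recurrence)
  show "norm (tau (int n)) * (norm q * x) ^ n * gauss_sum (y / norm q ^ n) \<ge> 0" for n
    using x y by (intro mult_nonneg_nonneg gauss_sum_nonneg) auto
  show "0 \<le> x * y" "x * y < 1" using x y xy by auto
  show "summable (\<lambda>n. norm (tau (int (Suc n))) * (norm q * x) ^ Suc n)"
    using summable_gauss by (rule iffD2[OF summable_Suc_iff])
  show "norm (tau (int (Suc n))) * (norm q * x) ^ Suc n \<ge> 0" for n
    using x by auto
  fix n
  have "y / norm q ^ n = norm q * (y / norm q ^ Suc n)" using q0 by simp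
  then have "gauss_sum (y / norm q ^ Suc n) = 1 + y / norm q ^ Suc n * gauss_sum (y / norm q ^ n)"
    using gauss_sum_step[of "y / norm q ^ Suc n"] by simp
  moreover have "norm (tau (int (Suc n))) * (norm q * x) ^ Suc n * (y / norm q ^ Suc n)
      = x * y * (norm (tau (int n)) * (norm q * x) ^ n)"
    using q0 by (simp only: tau_Suc) (simp add: norm_mult norm_power power_mult_distrib)
  ultimately show "norm (tau (int (Suc n))) * (norm q * x) ^ Suc n * gauss_sum (y / norm q ^ Suc n)
      = x * y * (norm (tau (int n)) * (norm q * x) ^ n * gauss_sum (y / norm q ^ n))
        + norm (tau (int (Suc n))) * (norm q * x) ^ Suc n"
    by (simp only: distrib_left mult_1_right mult.assoc[symmetric] add.commute)
qed

text \<open>Up to a factor independent of \<open>n\<close>, the summand of the \<open>q\<close>-integral at the node \<open>uq\<^sup>n/2\<close> (see \<open>node_term\<close>). At \<open>z = 0\<close> the series is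
  \<open>double_euler X (X / Y)\<close>.\<close>

definition lattice_term :: "complex \<Rightarrow> complex \<Rightarrow> complex \<Rightarrow> nat \<Rightarrow> complex" where
  "lattice_term X Y z n = euler_coeff n * (q * X) ^ n * qpoch_inf (q ^ Suc n * (X / Y)) q
      * qpoch_inf (z / (X * q ^ n)) q"

definition lattice_series :: "complex \<Rightarrow> complex \<Rightarrow> complex \<Rightarrow> complex" where
  "lattice_series X Y z = infsum (lattice_term X Y z) UNIV"

context
  fixes X Y z :: complex
  assumes X: "X \<noteq> 0" and z: "norm z < 1"
begin

text \<open>Expanding the last product of \<open>lattice_term\<close> by Euler's series gives a double series that still converges absolutely,
  because \<open>\<bar>z\<bar> < 1\<close>.\<close>

lemma lattice_double_summable:
  "(\<lambda>(n, l). euler_coeff n * (q * X) ^ n * qpoch_inf (q ^ Suc n * (X / Y)) q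
      * (euler_coeff l * (z / (X * q ^ n)) ^ l)) summable_on (UNIV \<times> UNIV)"
  (is "?f summable_on _")
proof -
  obtain K where K: "K > 0" "\<And>n. norm (1 / qq n) \<le> K" by (rule qq_inverse_bound) auto
  obtain C where C: "C > 0" "\<And>n. norm (qpoch_inf (q * (X / Y) * q ^ n) q) \<le> C"
    by (rule qpoch_shift_bound[of "q * (X / Y)"]) blast
  have ec: "norm (euler_coeff n) \<le> K * norm (tau (int n))" for n
  proof -
    have "norm (euler_coeff n) = norm (1 / qq n) * norm (tau (int n))"
      by (simp add: euler_coeff_def norm_divide)
    also have "\<dots> \<le> K * norm (tau (int n))" by (intro mult_right_mono K) simp
    finally show ?thesis .
  qed
  define y where "y = norm z / norm X"
  define D where "D = (\<lambda>n. C * K * K * (norm (tau (int n)) * (norm q * norm X) ^ n))"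
  define g where "g = (\<lambda>(n, l). D n * (norm (tau (int l)) * (y / norm q ^ n) ^ l))"
  have y: "y \<ge> 0" "norm X * y < 1" using X z by (auto simp: y_def)
  have D: "D n \<ge> 0" for n using C(1) K(1) by (simp add: D_def)
  have "g summable_on (UNIV \<times> UNIV)"
  proof (rule summable_on_SigmaI)
    fix n :: nat
    have "(\<lambda>l. norm (tau (int l)) * (y / norm q ^ n) ^ l) sums gauss_sum (y / norm q ^ n)"
      unfolding gauss_sum_def by (rule summable_sums[OF summable_gauss])
    then have "((\<lambda>l. norm (tau (int l)) * (y / norm q ^ n) ^ l) has_sum gauss_sum (y / norm q ^ n)) UNIV"
      by (rule sums_nonneg_imp_has_sum) (use y in auto)
    from has_sum_cmult_right[OF this, of "D n"]
    show "((\<lambda>l. g (n, l)) has_sum D n * gauss_sum (y / norm q ^ n)) UNIV"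
      by (simp add: g_def)
  next
    have "summable (\<lambda>n. C * K * K * (norm (tau (int n)) * (norm q * norm X) ^ n * gauss_sum (y / norm q ^ n)))"
      using X y by (intro summable_mult summable_gauss_sum) auto
    then have "summable (\<lambda>n. D n * gauss_sum (y / norm q ^ n))"
      by (simp only: D_def mult.assoc)
    then show "(\<lambda>n. D n * gauss_sum (y / norm q ^ n)) summable_on UNIV"
      using D y by (subst summable_on_UNIV_nonneg_real_iff) (auto intro!: mult_nonneg_nonneg gauss_sum_nonneg)
  next
    show "g (n, l) \<ge> 0" for n l
      using D[of n] y by (auto simp: g_def intro!: mult_nonneg_nonneg)
  qed
  then have "(\<lambda>p. norm (?f p)) summable_on (UNIV \<times> UNIV)"
  proof (rule Infinite_Sum.abs_summable_on_comparison_test')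
    fix p :: "nat \<times> nat"
    obtain n l where p: "p = (n, l)" by (cases p)
    have "norm (?f p) = norm (euler_coeff n) * (norm q * norm X) ^ n
        * norm (qpoch_inf (q * (X / Y) * q ^ n) q) * (norm (euler_coeff l) * (y / norm q ^ n) ^ l)"
      by (simp add: p y_def norm_mult norm_divide norm_power mult_ac)
    also have "\<dots> \<le> (K * norm (tau (int n))) * (norm q * norm X) ^ n * C
        * ((K * norm (tau (int l))) * (y / norm q ^ n) ^ l)"
      by (intro mult_mono ec C order_refl mult_nonneg_nonneg norm_ge_zero zero_le_power divide_nonneg_nonneg y)
         (use K C in auto)
    also have "\<dots> = g p" by (simp add: p g_def D_def mult_ac)
    finally show "norm (?f p) \<le> g p" .
  qed
  then show ?thesis by (rule abs_summable_summable)
qed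

lemma lattice_series_sums:
  shows has_sum_lattice: "(lattice_term X Y z has_sum lattice_series X Y z) UNIV"
    and has_sum_lattice_expanded:
      "((\<lambda>l. euler_coeff l * (z / X) ^ l * double_euler (X / q ^ l) (X / Y)) has_sum lattice_series X Y z) UNIV"
proof -
  let ?f = "\<lambda>(n, l). euler_coeff n * (q * X) ^ n * qpoch_inf (q ^ Suc n * (X / Y)) q
      * (euler_coeff l * (z / (X * q ^ n)) ^ l)"
  obtain S where S: "(?f has_sum S) (UNIV \<times> UNIV)"
    using lattice_double_summable by (auto simp: summable_on_def)
  have J: "(lattice_term X Y z has_sum S) UNIV"
  proof (rule has_sum_SigmaD[OF S])
    show "((\<lambda>l. ?f (n, l)) has_sum lattice_term X Y z n) UNIV" for n
      using has_sum_cmult_right[OF has_sum_euler[of "z / (X * q ^ n)"],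
          of "euler_coeff n * (q * X) ^ n * qpoch_inf (q ^ Suc n * (X / Y)) q"]
      by (simp add: lattice_term_def)
  qed
  then have SJ: "S = lattice_series X Y z" by (simp add: lattice_series_def infsumI)
  with J show "(lattice_term X Y z has_sum lattice_series X Y z) UNIV" by simp
  have "((\<lambda>(l, n). ?f (n, l)) has_sum S) (UNIV \<times> UNIV)"
    using S by (subst (asm) has_sum_swap)
  then have "((\<lambda>l. euler_coeff l * (z / X) ^ l * double_euler (X / q ^ l) (X / Y)) has_sum S) UNIV"
  proof (rule has_sum_SigmaD)
    fix l
    have "(\<lambda>n. euler_coeff l * (z / X) ^ l * (euler_coeff n * (q * (X / q ^ l)) ^ n * qpoch_inf (q ^ Suc n * (X / Y)) q))
        = (\<lambda>n. ?f (n, l))"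
      using q0 by (intro ext) (simp add: power_divide power_mult_distrib mult.commute mult.left_commute flip: power_mult)
    with has_sum_cmult_right[OF has_sum_double_euler[of "X / q ^ l" "X / Y"], of "euler_coeff l * (z / X) ^ l"]
    show "((\<lambda>n. case (l, n) of (l, n) \<Rightarrow> ?f (n, l)) has_sum
        euler_coeff l * (z / X) ^ l * double_euler (X / q ^ l) (X / Y)) UNIV"
      by simp
  qed
  then show "((\<lambda>l. euler_coeff l * (z / X) ^ l * double_euler (X / q ^ l) (X / Y)) has_sum lattice_series X Y z) UNIV"
    by (simp add: SJ)
qed

end

lemma theta_mult_q: "x \<noteq> 0 \<Longrightarrow> theta (x * q) * x = - theta x"
proof -
  assume x: "x \<noteq> 0"
  have 1: "qpoch_inf (1 / x) q = (1 - 1 / x) * qpoch_inf (q / x) q"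
    using qpoch_inf_Suc[of "1 / x"] by simp
  have 2: "q / (x * q) = 1 / x" using q0 by simp
  have "theta (x * q) * x = ((1 - 1 / x) * x) * qpoch_inf (x * q) q * qpoch_inf (q / x) q"
    unfolding theta_def 2 1 by (simp only: mult_ac)
  also have "(1 - 1 / x) * x = - (1 - x)" using x by (simp add: algebra_simps)
  also have "- (1 - x) * qpoch_inf (x * q) q * qpoch_inf (q / x) q = - theta x"
    unfolding theta_def qpoch_inf_Suc[of x] by (simp add: algebra_simps)
  finally show ?thesis .
qed

text \<open>Quasi-periodicity, written without division.\<close>

lemma theta_divide_q_power:
  assumes x: "x \<noteq> 0"
  shows "theta (x / q ^ l) * (tau (int l) * q ^ l) = x ^ l * theta x"
proof (induction l)
  case (Suc l)
  have "theta (x / q ^ Suc l) = - (x / q ^ Suc l * theta (x / q ^ Suc l * q))"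
    using theta_mult_q[of "x / q ^ Suc l"] x q0 by (simp add: mult.commute)
  also have "x / q ^ Suc l * q = x / q ^ l" using q0 by simp
  finally have "theta (x / q ^ Suc l) * (tau (int (Suc l)) * q ^ Suc l)
      = x / q ^ Suc l * q ^ Suc l * (theta (x / q ^ l) * (tau (int l) * q ^ l))"
    by (simp only: tau_Suc) (simp add: mult_ac)
  also have "\<dots> = x * (x ^ l * theta x)" unfolding Suc.IH using q0 by simp
  finally show ?case by simp
qed simp

lemma theta_inverse: "x \<noteq> 0 \<Longrightarrow> theta (1 / x) * x = - theta x"
proof -
  assume x: "x \<noteq> 0"
  have "theta (1 / x) = theta (x * q)"
    using q0 by (simp add: theta_def mult.commute)
  then show ?thesis using theta_mult_q[OF x] by simp
qed

text \<open>The right-hand side must have its arguments in this order to match \<open>connection_series\<close>. The order is reversed by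
  exchanging \<open>X\<close> and \<open>Y\<close> in \<open>theta_three_term\<close> and using the reflection \<open>theta_inverse\<close>.\<close>

lemma theta_three_term':
  assumes X: "X \<noteq> 0" and Y: "Y \<noteq> 0"
  shows "theta Y * double_euler X (X / Y) - Y / X * (theta X * double_euler Y (Y / X))
       = theta (Y / X) * double_euler (1 / Y) (1 / X)"
proof -
  have "theta Y * double_euler X (X / Y) - Y / X * (theta X * double_euler Y (Y / X))
      = - (Y / X) * (theta X * double_euler Y (Y / X) - X / Y * (theta Y * double_euler X (X / Y)))"
    using X Y by (simp add: field_simps)
  also have "\<dots> = - (theta (1 / (Y / X)) * (Y / X)) * double_euler (1 / Y) (1 / X)"
    unfolding theta_three_term[OF Y X] by simp
  also have "\<dots> = theta (Y / X) * double_euler (1 / Y) (1 / X)"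
    using theta_inverse[of "Y / X"] X Y by simp
  finally show ?thesis .
qed

text \<open>The terms of a \<open>\<^sub>1\<phi>\<^sub>1\<close> series with numerator parameter \<open>z/X\<close>, denominator parameter \<open>q/X\<close> and argument
  \<open>q/Y\<close>, multiplied by \<open>(q/X;q)\<^sub>\<infinity>\<close> so that no denominator can vanish.\<close>

definition connection_term :: "complex \<Rightarrow> complex \<Rightarrow> complex \<Rightarrow> nat \<Rightarrow> complex" where
  "connection_term X Y z m = euler_coeff m * (q / Y) ^ m * qpoch (z / X) q m * qpoch_inf (q ^ Suc m / X) q"

definition connection_series :: "complex \<Rightarrow> complex \<Rightarrow> complex \<Rightarrow> complex" where
  "connection_series X Y z = infsum (connection_term X Y z) UNIV"

text \<open>The expansion in powers of \<open>z\<close>: both sides come from one double series over \<open>(l, j)\<close>. Summing over \<open>j\<close> first gives the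
  double Euler series, and collecting \<open>m = l + j\<close> gives \<open>(z/X;q)\<^sub>m\<close> by the finite \<open>q\<close>-binomial theorem.\<close>

lemma has_sum_connection_expanded:
  "((\<lambda>l. euler_coeff l * tau (int l) * (q * z / (X * Y)) ^ l * double_euler (q ^ l / Y) (q ^ l / X))
      has_sum connection_series X Y z) UNIV"
proof -
  define d where "d = (\<lambda>(l, j). euler_coeff l * tau (int l) * (q * z / (X * Y)) ^ l
      * (euler_coeff j * (q * (q ^ l / Y)) ^ j * qpoch_inf (q ^ Suc j * (q ^ l / X)) q))"
  obtain C where C: "C > 0" "\<And>n. norm (qpoch_inf (q / X * q ^ n) q) \<le> C"
    by (rule qpoch_shift_bound[of "q / X"]) blast
  have tau1: "norm (tau (int l)) \<le> 1" for l
    using q1 tri_nonneg[of "int l"] by (simp add: tau_def norm_mult norm_power norm_power_int power_int_le_one)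
  define e where "e = (\<lambda>(l, j). euler_coeff l * (q * z / (X * Y)) ^ l * (euler_coeff j * (q / Y) ^ j))"
  have "e summable_on (UNIV \<times> UNIV)"
    unfolding e_def using has_sum_complex_product[OF has_sum_euler has_sum_euler] by (auto simp: summable_on_def)
  then have "(\<lambda>p. C * norm (e p)) summable_on (UNIV \<times> UNIV)"
    by (intro summable_on_cmult_right) (simp only: summable_on_iff_abs_summable_on_complex)
  then have "(\<lambda>p. norm (d p)) summable_on (UNIV \<times> UNIV)"
  proof (rule Infinite_Sum.abs_summable_on_comparison_test')
    fix p :: "nat \<times> nat"
    obtain l j where p: "p = (l, j)" by (cases p)
    have "norm q ^ (l * j) \<le> 1" using q1 by (intro power_le_one) auto
    then have 1: "norm (tau (int l)) * norm q ^ (l * j) * norm (qpoch_inf (q / X * q ^ (j + l)) q) \<le> 1 * 1 * C"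
      using C(1) by (intro mult_mono tau1 C) auto
    have "norm (d p) = norm (e p) * (norm (tau (int l)) * norm q ^ (l * j) * norm (qpoch_inf (q / X * q ^ (j + l)) q))"
      by (simp add: p d_def e_def norm_mult norm_divide norm_power power_mult_distrib power_divide power_add mult_ac flip: power_mult)
    also have "\<dots> \<le> norm (e p) * C"
      using 1 by (intro mult_left_mono) auto
    finally show "norm (d p) \<le> C * norm (e p)" by (simp add: mult.commute)
  qed
  then have "d summable_on (UNIV \<times> UNIV)" by (rule abs_summable_summable)
  then obtain S where S: "(d has_sum S) (UNIV \<times> UNIV)" by (auto simp: summable_on_def)
  have L: "((\<lambda>l. euler_coeff l * tau (int l) * (q * z / (X * Y)) ^ l * double_euler (q ^ l / Y) (q ^ l / X))
          has_sum S) UNIV"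
  proof (rule has_sum_SigmaD[OF S])
    show "((\<lambda>j. d (l, j)) has_sum euler_coeff l * tau (int l) * (q * z / (X * Y)) ^ l * double_euler (q ^ l / Y) (q ^ l / X)) UNIV" for l
      unfolding d_def prod.case by (intro has_sum_cmult_right has_sum_double_euler)
  qed
  have "((\<lambda>(m, l). d (l, m - l)) has_sum S) (SIGMA m:UNIV. {..m}) \<longleftrightarrow> (d has_sum S) (UNIV \<times> UNIV)"
    by (rule has_sum_reindex_bij_witness[where j = "\<lambda>(m, l). (l, m - l)" and i = "\<lambda>(l, j). (l + j, l)"]) auto
  with S have tri_sum: "((\<lambda>(m, l). d (l, m - l)) has_sum S) (SIGMA m:UNIV. {..m})" by blast
  have M: "(connection_term X Y z has_sum S) UNIV"
  proof (rule has_sum_SigmaD[OF tri_sum])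
    fix m
    have "d (l, m - l) = tau (int m) * (q / Y) ^ m * qpoch_inf (q ^ Suc m / X) q
        * (euler_coeff l * (z / X) ^ l / qq (m - l))" if lm: "l \<le> m" for l
    proof -
      obtain j where j: "m = l + j" using le_Suc_ex[OF lm] by auto
      have t: "tau (int (l + j)) = tau (int l) * tau (int j) * q ^ (l * j)"
        by (simp only: of_nat_add tau_add of_nat_mult[symmetric] power_int_of_nat)
      have x: "q ^ Suc j * (q ^ l / X) = q ^ Suc (l + j) / X"
        by (simp add: power_add mult_ac)
      have y: "(q * (q ^ l / Y)) ^ j = (q / Y) ^ j * q ^ (l * j)"
        by (simp add: power_mult_distrib power_divide power_mult)
      have "(q * z / (X * Y)) = (q / Y) * (z / X)" by simp
      then have xy: "(q * z / (X * Y)) ^ l = (q / Y) ^ l * (z / X) ^ l"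
        by (simp only: power_mult_distrib)
      have e: "euler_coeff j = tau (int j) * (1 / qq j)" by (simp add: euler_coeff_def)
      have "d (l, j) = tau (int l) * tau (int j) * q ^ (l * j) * ((q / Y) ^ l * (q / Y) ^ j)
          * qpoch_inf (q ^ Suc (l + j) / X) q * (euler_coeff l * (z / X) ^ l * (1 / qq j))"
        unfolding d_def prod.case x y xy e by (simp only: mult_ac)
      then show ?thesis
        unfolding j t by (simp add: power_add del: power_Suc)
    qed
    then have "(\<Sum>l\<le>m. d (l, m - l)) = tau (int m) * (q / Y) ^ m * qpoch_inf (q ^ Suc m / X) q
        * (\<Sum>l\<le>m. euler_coeff l * (z / X) ^ l / qq (m - l))"
      by (simp add: sum_distrib_left)
    also have "\<dots> = connection_term X Y z m"
      unfolding finite_binomial by (simp add: connection_term_def euler_coeff_def)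
    finally show "((\<lambda>l. case (m, l) of (m, l) \<Rightarrow> d (l, m - l)) has_sum connection_term X Y z m) {..m}"
      using has_sum_finite[of "{..m}" "\<lambda>l. d (l, m - l)"] by simp
  qed
  then have "S = connection_series X Y z" by (simp add: connection_series_def infsumI)
  with L show ?thesis by simp
qed

text \<open>The coefficient of \<open>z\<^sup>l\<close> is \<open>theta_three_term'\<close> at \<open>X/q\<^sup>l\<close> and \<open>Y/q\<^sup>l\<close>; quasi-periodicity of theta moves the shift
  out of the coefficients.\<close>

theorem lattice_three_term:
  assumes X: "X \<noteq> 0" and Y: "Y \<noteq> 0" and z: "norm z < 1"
  shows "theta Y * lattice_series X Y z - Y / X * (theta X * lattice_series Y X z) = theta (Y / X) * connection_series X Y z"
proof -
  define a where "a = (\<lambda>X Y l. euler_coeff l * (z / X) ^ l * double_euler (X / q ^ l) (X / Y))"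
  define b where "b = (\<lambda>l. euler_coeff l * tau (int l) * (q * z / (X * Y)) ^ l * double_euler (q ^ l / Y) (q ^ l / X))"
  have rel: "theta Y * a X Y l - Y / X * (theta X * a Y X l) = theta (Y / X) * b l" for l
  proof -
    have ql: "q ^ l \<noteq> 0" using q0 by simp
    have nz: "X / q ^ l \<noteq> 0" "Y / q ^ l \<noteq> 0" using X Y ql by auto
    let ?t = "tau (int l) * q ^ l"
    let ?H1 = "double_euler (X / q ^ l) (X / Y)" and ?H2 = "double_euler (Y / q ^ l) (Y / X)"
      and ?H3 = "double_euler (q ^ l / Y) (q ^ l / X)"
    have "theta (Y / q ^ l) * ?H1 - Y / X * (theta (X / q ^ l) * ?H2) = theta (Y / X) * ?H3"
    proof -
      have "(X / q ^ l) / (Y / q ^ l) = X / Y" "(Y / q ^ l) / (X / q ^ l) = Y / X"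
        "1 / (Y / q ^ l) = q ^ l / Y" "1 / (X / q ^ l) = q ^ l / X"
        using ql X Y by (simp_all add: field_simps)
      with theta_three_term'[OF nz] show ?thesis by (simp only:)
    qed
    then have e1: "(theta (Y / q ^ l) * ?H1 - Y / X * (theta (X / q ^ l) * ?H2)) * ?t = theta (Y / X) * ?H3 * ?t"
      by (rule arg_cong)
    have e2: "(theta (Y / q ^ l) * ?H1 - Y / X * (theta (X / q ^ l) * ?H2)) * ?t
        = theta (Y / q ^ l) * ?t * ?H1 - Y / X * (theta (X / q ^ l) * ?t * ?H2)"
      by (simp only: left_diff_distrib right_diff_distrib mult_ac)
    have m: "Y ^ l * theta Y * ?H1 - Y / X * (X ^ l * theta X * ?H2) = theta (Y / X) * ?H3 * ?t"
      using trans[OF sym[OF e2] e1] unfolding theta_divide_q_power[OF X] theta_divide_q_power[OF Y] .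
    \<comment> \<open>The factor by which the shifted three-term identity has to be multiplied.\<close>
    define w where "w = z ^ l / (X ^ l * Y ^ l)"
    have w: "(z / X) ^ l = w * Y ^ l" "(z / Y) ^ l = w * X ^ l" "(q * z / (X * Y)) ^ l = w * q ^ l"
      using X Y by (simp_all add: w_def power_divide power_mult_distrib)
    have "theta Y * a X Y l - Y / X * (theta X * a Y X l)
        = euler_coeff l * w * (Y ^ l * theta Y * ?H1 - Y / X * (X ^ l * theta X * ?H2))"
      unfolding a_def w by (simp only: right_diff_distrib mult_ac)
    also have "\<dots> = theta (Y / X) * b l"
      unfolding m b_def w by (simp only: mult_ac)
    finally show ?thesis .
  qed
  have "((\<lambda>l. theta Y * a X Y l) has_sum theta Y * lattice_series X Y z) UNIV"
    unfolding a_def by (intro has_sum_cmult_right has_sum_lattice_expanded X z)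
  moreover have "((\<lambda>l. Y / X * (theta X * a Y X l)) has_sum Y / X * (theta X * lattice_series Y X z)) UNIV"
    unfolding a_def by (intro has_sum_cmult_right has_sum_lattice_expanded Y z)
  ultimately have "((\<lambda>l. theta Y * a X Y l + - (Y / X * (theta X * a Y X l))) has_sum
      theta Y * lattice_series X Y z + - (Y / X * (theta X * lattice_series Y X z))) UNIV"
    by (intro has_sum_add has_sum_uminusI)
  then have "((\<lambda>l. theta (Y / X) * b l) has_sum
      theta Y * lattice_series X Y z - Y / X * (theta X * lattice_series Y X z)) UNIV"
    by (simp only: rel[symmetric] diff_conv_add_uminus)
  moreover have "((\<lambda>l. theta (Y / X) * b l) has_sum theta (Y / X) * connection_series X Y z) UNIV"
    unfolding b_def by (intro has_sum_cmult_right has_sum_connection_expanded)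
  ultimately show ?thesis by (rule has_sum_unique)
qed

text \<open>Heine's transformation. The ratio \<open>(q\<^bsup>m+1\<^esup>/X;q)\<^sub>\<infinity> / (aq\<^sup>m;q)\<^sub>\<infinity>\<close> is a \<open>q\<close>-binomial series in
  \<open>aq\<^sup>m\<close>, which requires \<open>\<bar>a\<bar> < 1\<close> for \<open>a = z/X\<close>; exchanging the sums, the sum over \<open>m\<close> is Euler's series.\<close>

theorem connection_series_eq_phi21:
  assumes X: "X \<noteq> 0" and z: "z \<noteq> 0" and a: "norm (z / X) < 1"
    and B: "qpoch_inf (q / Y) q \<noteq> 0"
  shows "connection_series X Y z = qpoch_inf (z / X) q * (qpoch_inf (q / Y) q * phi21 (q / z) 0 (q / Y) q (z / X))"
proof -
  define a where "a = z / X"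
  define A where "A = q / z"
  have aq: "norm (a * q ^ m) < 1" for m
  proof -
    have "norm q ^ m \<le> 1" using q1 by (intro power_le_one) auto
    then have "norm a * norm q ^ m \<le> norm a" by (intro mult_left_le) auto
    moreover have "norm a < 1" using a by (simp only: a_def)
    ultimately show ?thesis by (simp only: norm_mult norm_power le_less_trans)
  qed
  have nz: "qpoch_inf (a * q ^ m) q \<noteq> 0" for m
  proof (rule qpoch_inf_nonzero)
    fix j
    have "norm (a * q ^ m * q ^ j) < 1" using aq[of "m + j"] by (simp add: power_add mult.assoc)
    then show "a * q ^ m * q ^ j \<noteq> 1" by fastforce
  qed
  have Aa: "A * (a * q ^ m) = q ^ Suc m / X" for m
    using z by (simp add: A_def a_def)
  define d where "d = (\<lambda>(m, n). euler_coeff m * (q / Y) ^ m * (binom_coeff A n * (a * q ^ m) ^ n))"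
  define e where "e = (\<lambda>(m, n). euler_coeff m * (q / Y) ^ m * (binom_coeff A n * a ^ n))"
  have "((\<lambda>n. binom_coeff A n * a ^ n) has_sum qpoch_inf (A * a) q / qpoch_inf a q) UNIV"
    using aq[of 0] nz[of 0] by (intro has_sum_binom) simp_all
  then have "(e has_sum qpoch_inf (q / Y) q * (qpoch_inf (A * a) q / qpoch_inf a q)) (UNIV \<times> UNIV)"
    unfolding e_def by (intro has_sum_complex_product has_sum_euler)
  then have "e summable_on (UNIV \<times> UNIV)"
    by (auto simp: summable_on_def)
  then have "(\<lambda>p. norm (e p)) summable_on (UNIV \<times> UNIV)"
    by (simp only: summable_on_iff_abs_summable_on_complex)
  then have "(\<lambda>p. norm (d p)) summable_on (UNIV \<times> UNIV)"
  proof (rule Infinite_Sum.abs_summable_on_comparison_test')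
    fix p :: "nat \<times> nat"
    obtain m n where p: "p = (m, n)" by (cases p)
    have 1: "norm q ^ (m * n) \<le> 1" using q1 by (intro power_le_one) auto
    have "norm (d p) = norm (e p) * norm q ^ (m * n)"
      by (simp add: p d_def e_def norm_mult norm_divide norm_power power_mult_distrib flip: power_mult)
    also have "\<dots> \<le> norm (e p)"
      using 1 by (intro mult_left_le) auto
    finally show "norm (d p) \<le> norm (e p)" .
  qed
  then have "d summable_on (UNIV \<times> UNIV)" by (rule abs_summable_summable)
  then obtain S where S: "(d has_sum S) (UNIV \<times> UNIV)" by (auto simp: summable_on_def)
  have "((\<lambda>m. euler_coeff m * (q / Y) ^ m * (qpoch_inf (q ^ Suc m / X) q / qpoch_inf (a * q ^ m) q)) has_sum S) UNIV"
  proof (rule has_sum_SigmaD[OF S])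
    show "((\<lambda>n. d (m, n)) has_sum euler_coeff m * (q / Y) ^ m
        * (qpoch_inf (q ^ Suc m / X) q / qpoch_inf (a * q ^ m) q)) UNIV" for m
      using has_sum_cmult_right[OF has_sum_binom[OF aq nz, of A m]] unfolding Aa by (simp add: d_def)
  qed
  from has_sum_cmult_right[OF this, of "qpoch_inf a q"]
  have "(connection_term X Y z has_sum qpoch_inf a q * S) UNIV"
  proof (rule has_sum_cong[THEN iffD1, rotated])
    fix m
    show "qpoch_inf a q * (euler_coeff m * (q / Y) ^ m * (qpoch_inf (q ^ Suc m / X) q / qpoch_inf (a * q ^ m) q))
        = connection_term X Y z m"
      unfolding qpoch_inf_split[of a m] connection_term_def a_def[symmetric] using nz[of m] by simp
  qed
  then have 1: "connection_series X Y z = qpoch_inf a q * S" by (simp add: connection_series_def infsumI)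
  have swapped: "((\<lambda>(n, m). d (m, n)) has_sum S) (UNIV \<times> UNIV)"
    using S by (subst (asm) has_sum_swap)
  have "((\<lambda>n. binom_coeff A n * a ^ n * qpoch_inf (q / Y * q ^ n) q) has_sum S) UNIV"
  proof (rule has_sum_SigmaD[OF swapped])
    fix n
    have "(\<lambda>m. binom_coeff A n * a ^ n * (euler_coeff m * (q / Y * q ^ n) ^ m)) = (\<lambda>m. d (m, n))"
    proof (rule ext)
      fix m
      have "(q ^ n) ^ m = (q ^ m) ^ n" by (simp add: mult.commute flip: power_mult)
      then show "binom_coeff A n * a ^ n * (euler_coeff m * (q / Y * q ^ n) ^ m) = d (m, n)"
        unfolding d_def prod.case power_mult_distrib by (simp only: mult_ac)
    qed
    with has_sum_cmult_right[OF has_sum_euler[of "q / Y * q ^ n"], of "binom_coeff A n * a ^ n"]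
    show "((\<lambda>m. case (n, m) of (n, m) \<Rightarrow> d (m, n)) has_sum
        binom_coeff A n * a ^ n * qpoch_inf (q / Y * q ^ n) q) UNIV" by (simp only: prod.case)
  qed
  moreover have "binom_coeff A n * a ^ n * qpoch_inf (q / Y * q ^ n) q = qpoch_inf (q / Y) q *
      (qpoch A q n * qpoch 0 q n / (qq n * qpoch (q / Y) q n) * a ^ n)" for n
    using qpoch_nonzero[OF B, of n] qpoch_inf_split[of "q / Y" n] by (simp add: binom_coeff_def field_simps)
  ultimately have "((\<lambda>n. qpoch_inf (q / Y) q *
      (qpoch A q n * qpoch 0 q n / (qq n * qpoch (q / Y) q n) * a ^ n)) has_sum S) UNIV" by simp
  from has_sum_cmult_right[OF this, of "1 / qpoch_inf (q / Y) q"]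
  have "((\<lambda>n. qpoch A q n * qpoch 0 q n / (qq n * qpoch (q / Y) q n) * a ^ n) has_sum S / qpoch_inf (q / Y) q) UNIV"
    using B by simp
  then have "phi21 A 0 (q / Y) q a = S / qpoch_inf (q / Y) q"
    unfolding phi21_def by (intro sums_unique[symmetric] has_sum_imp_sums)
  then have "S = qpoch_inf (q / Y) q * phi21 A 0 (q / Y) q a" using B by simp
  with 1 show ?thesis by (simp add: a_def A_def)
qed

section \<open>The node sums and the recurrence\<close>

lemma theta_mult_q_power:
  assumes x: "x \<noteq> 0"
  shows "theta (x * q ^ n) * (tau (int n) * x ^ n) = theta x"
proof -
  have t: "tau (int n) * q ^ n \<noteq> 0" and nz: "x * q ^ n \<noteq> 0" using q0 x by auto
  have "theta x * (tau (int n) * q ^ n) = (x * q ^ n) ^ n * theta (x * q ^ n)"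
    using theta_divide_q_power[OF nz, of n] q0 by simp
  also have "(x * q ^ n) ^ n = x ^ n * q ^ (n * n)"
    by (simp add: power_mult_distrib power_mult)
  also have "\<dots> = tau (int n) * x ^ n * (tau (int n) * q ^ n)"
    unfolding tau_square[symmetric] by (simp only: mult_ac)
  finally have "(tau (int n) * q ^ n) * (theta (x * q ^ n) * (tau (int n) * x ^ n)) = (tau (int n) * q ^ n) * theta x"
    by (simp only: mult_ac)
  then show ?thesis by (rule mult_left_cancel[OF t, THEN iffD1])
qed

lemma qpoch_inf_divide_q_power:
  assumes Y: "Y \<noteq> 0" "qpoch_inf Y q \<noteq> 0"
  shows "qpoch_inf (q / (Y * q ^ k)) q * (tau (int k) * Y ^ k) = qpoch Y q k * qpoch_inf (q / Y) q"
proof -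
  have nz: "qpoch_inf (Y * q ^ k) q \<noteq> 0"
    using Y(2) qpoch_inf_split[of Y k] by auto
  have "qpoch_inf (Y * q ^ k) q * (qpoch_inf (q / (Y * q ^ k)) q * (tau (int k) * Y ^ k))
      = qpoch_inf (Y * q ^ k) q * (qpoch Y q k * qpoch_inf (q / Y) q)"
    using theta_mult_q_power[OF Y(1), of k] unfolding theta_def qpoch_inf_split[of Y k]
    by (simp only: mult_ac)
  then show ?thesis by (rule mult_left_cancel[OF nz, THEN iffD1])
qed

definition weight :: "complex \<Rightarrow> complex \<Rightarrow> complex \<Rightarrow> complex \<Rightarrow> complex \<Rightarrow> complex \<Rightarrow> complex" where
  "weight b c lam u v t = qpoch_inf (2 * q * u * t) q * qpoch_inf (2 * q * v * t) q
     * qpoch_inf (- (lam * q / (4 * b * c * t))) q / theta (4 * c * t)"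

lemma weight_commute: "weight b c lam u v t = weight b c lam v u t"
  by (simp add: weight_def mult_ac)

lemma p_integrand_eq_weight:
  "p_integrand q b c lam \<theta> k t = t ^ k * weight b c lam (exp (\<i> * \<theta>)) (exp (- \<i> * \<theta>)) t"
  by (simp add: p_integrand_def weight_def theta_def)

definition node_sum :: "complex \<Rightarrow> complex \<Rightarrow> complex \<Rightarrow> complex \<Rightarrow> complex \<Rightarrow> nat \<Rightarrow> complex" where
  "node_sum b c lam u v k = (\<Sum>n. q ^ n * ((u / 2 * q ^ n) ^ k * weight b c lam u v (u / 2 * q ^ n)))"

context
  fixes b c lam u v :: complex
  assumes b: "b \<noteq> 0" and c: "c \<noteq> 0" and lam: "norm (lam * q / b) < 1" and uv: "u * v = 1"
begin

lemma u_nonzero: "u \<noteq> 0"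
  using uv by auto

lemma v_eq: "v = 1 / u"
  using uv u_nonzero by (simp add: eq_divide_eq mult.commute)

text \<open>Quasi-periodicity of theta at the node produces the Gaussian factor, and the product
  \<open>(q\<^bsup>n+1\<^esup>;q)\<^sub>\<infinity>\<close> coming from \<open>v\<close> produces \<open>1/(q;q)\<^sub>n\<close>.\<close>

lemma node_term:
  "q ^ n * ((u / 2 * q ^ n) ^ k * weight b c lam u v (u / 2 * q ^ n))
     = (u / 2) ^ k * qpoch_inf q q / theta (2 * c * u)
       * lattice_term (2 * c * u * q ^ k) (2 * c * v * q ^ k) (- (lam * q / b) * q ^ k) n"
proof -
  note u = u_nonzero
  define X where "X = 2 * c * u"
  have X: "X \<noteq> 0" using c u by (simp add: X_def)
  have qn: "q ^ n \<noteq> 0" "q ^ k \<noteq> 0" using q0 by auto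
  have 1: "2 * q * u * (u / 2 * q ^ n) = q ^ Suc n * (2 * c * u * q ^ k / (2 * c * v * q ^ k))"
    using c u qn by (simp add: v_eq)
  have 2: "2 * q * v * (u / 2 * q ^ n) = q * q ^ n"
    using u by (simp add: v_eq)
  have 3: "- (lam * q / (4 * b * c * (u / 2 * q ^ n))) = - (lam * q / b) * q ^ k / (2 * c * u * q ^ k * q ^ n)"
    using b c u qn by (simp add: field_simps)
  have 4: "4 * c * (u / 2 * q ^ n) = X * q ^ n" by (simp add: X_def)
  have th: "1 / theta (X * q ^ n) = tau (int n) * X ^ n / theta X"
  proof -
    have "tau (int n) * X ^ n \<noteq> 0" using X by simp
    then show ?thesis
      unfolding theta_mult_q_power[OF X, of n, symmetric] by (simp add: divide_simps)
  qed
  have qq: "qpoch_inf (q * q ^ n) q = qpoch_inf q q * (1 / qq n)"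
    using qpoch_inf_split[of q n] by simp
  have e: "euler_coeff n = tau (int n) * (1 / qq n)" by (simp add: euler_coeff_def)
  have pw: "(u / 2 * q ^ n) ^ k = (u / 2) ^ k * q ^ (n * k)"
    by (simp add: power_mult_distrib power_divide power_mult)
  have pw': "(q * (X * q ^ k)) ^ n = q ^ n * (X ^ n * q ^ (n * k))"
    by (simp add: power_mult_distrib power_mult mult.commute)
  let ?A = "qpoch_inf (q ^ Suc n * (2 * c * u * q ^ k / (2 * c * v * q ^ k))) q"
  let ?B = "qpoch_inf (- (lam * q / b) * q ^ k / (2 * c * u * q ^ k * q ^ n)) q"
  have "weight b c lam u v (u / 2 * q ^ n)
      = ?A * (qpoch_inf q q * (1 / qq n)) * ?B * (tau (int n) * X ^ n / theta X)"
    unfolding weight_def 1 2 3 4 qq th[symmetric] by simp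
  then have "q ^ n * ((u / 2 * q ^ n) ^ k * weight b c lam u v (u / 2 * q ^ n))
    = (u / 2) ^ k * qpoch_inf q q / theta X *
      (tau (int n) * (1 / qq n) * (q ^ n * (X ^ n * q ^ (n * k))) * ?A * ?B)"
    unfolding pw by (simp add: mult_ac)
  then show ?thesis
    unfolding lattice_term_def e X_def[symmetric] pw' .
qed

lemma norm_z_power: "norm (- (lam * q / b) * q ^ k) < 1"
proof -
  have "norm q ^ k \<le> 1" using q1 by (intro power_le_one) auto
  then have "norm (lam * q / b) * norm q ^ k \<le> norm (lam * q / b)" by (intro mult_left_le) auto
  with lam show ?thesis by (simp only: norm_mult norm_power norm_minus_cancel le_less_trans)
qed

lemma node_sums:
  "(\<lambda>n. q ^ n * ((u / 2 * q ^ n) ^ k * weight b c lam u v (u / 2 * q ^ n))) sums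
     ((u / 2) ^ k * qpoch_inf q q / theta (2 * c * u)
       * lattice_series (2 * c * u * q ^ k) (2 * c * v * q ^ k) (- (lam * q / b) * q ^ k))"
proof -
  have "2 * c * u * q ^ k \<noteq> 0" using c u_nonzero q0 by simp
  from has_sum_lattice[OF this norm_z_power[of k]]
  show ?thesis unfolding node_term
    by (intro sums_mult has_sum_imp_sums)
qed

lemma node_sum_eq:
  "node_sum b c lam u v k = (u / 2) ^ k * qpoch_inf q q / theta (2 * c * u)
       * lattice_series (2 * c * u * q ^ k) (2 * c * v * q ^ k) (- (lam * q / b) * q ^ k)"
  unfolding node_sum_def by (rule sums_unique[OF node_sums, symmetric])

lemma node_sums': "(\<lambda>n. q ^ n * ((u / 2 * q ^ n) ^ k * weight b c lam u v (u / 2 * q ^ n))) sums node_sum b c lam u v k"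
  using node_sums[of k] by (simp only: node_sum_eq)

text \<open>The \<open>q\<close>-analogue of a Pearson equation for the weight.\<close>

lemma weight_shift:
  assumes t: "t \<noteq> 0"
  shows "(1 - 2 * u * (t * q)) * (1 - 2 * v * (t * q)) * weight b c lam u v (t * q)
     = - (4 * c * t + lam / b) * weight b c lam u v t"
proof -
  have 1: "qpoch_inf (2 * q * w * t) q = (1 - 2 * w * (t * q)) * qpoch_inf (2 * q * w * (t * q)) q" for w
    using qpoch_inf_Suc[of "2 * q * w * t"] by (simp add: mult_ac)
  have 2: "qpoch_inf (- (lam * q / (4 * b * c * (t * q)))) q
      = (1 + lam / (4 * b * c * t)) * qpoch_inf (- (lam * q / (4 * b * c * t))) q"
  proof -
    have "lam * q / (4 * b * c * (t * q)) = lam / (4 * b * c * t)"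
      using q0 by (simp add: mult_ac)
    then show ?thesis
      using qpoch_inf_Suc[of "- (lam / (4 * b * c * t))"] by simp
  qed
  have nz: "4 * c * t \<noteq> 0" using c t by simp
  define A where "A = theta (4 * c * (t * q))"
  have "theta (4 * c * t) = - (A * (4 * c * t))"
    using theta_mult_q[OF nz] unfolding A_def by (simp only: mult.assoc minus_minus)
  then have "1 / A = - (4 * c * t) * (1 / theta (4 * c * t))"
    using nz by simp
  then have 3: "1 / theta (4 * c * (t * q)) = - (4 * c * t) * (1 / theta (4 * c * t))"
    unfolding A_def .
  have 4: "(1 + lam / (4 * b * c * t)) * (- (4 * c * t)) = - (4 * c * t + lam / b)"
    using b c t by (simp add: field_simps)
  have "(1 - 2 * u * (t * q)) * (1 - 2 * v * (t * q)) * weight b c lam u v (t * q)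
      = qpoch_inf (2 * q * u * t) q * qpoch_inf (2 * q * v * t) q
        * qpoch_inf (- (lam * q / (4 * b * c * (t * q)))) q * (1 / theta (4 * c * (t * q)))"
    unfolding weight_def 1 by simp
  also have "\<dots> = ((1 + lam / (4 * b * c * t)) * (- (4 * c * t))) *
      (qpoch_inf (2 * q * u * t) q * qpoch_inf (2 * q * v * t) q
        * qpoch_inf (- (lam * q / (4 * b * c * t))) q * (1 / theta (4 * c * t)))"
    unfolding 2 3 by (simp only: mult_ac)
  also have "\<dots> = - (4 * c * t + lam / b) * weight b c lam u v t"
    unfolding 4 weight_def by simp
  finally show ?thesis .
qed

text \<open>The defect of the recurrence, summed over the nodes, telescopes with \<open>G(t) = t\<^sup>k(1 - 2ut)(1 - 2vt)w(t)\<close>.\<close>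

lemma node_sum_recurrence:
  assumes k: "k > 0"
  shows "(u + v) / 2 * node_sum b c lam u v k = node_sum b c lam u v (k + 1)
    + c * q ^ k * node_sum b c lam u v k + 1 / 4 * (1 + lam * q ^ k / b) * node_sum b c lam u v (k - 1)"
proof -
  define t where "t n = u / 2 * q ^ n" for n
  define f where "f k n = q ^ n * (t n ^ k * weight b c lam u v (t n))" for k n
  define G where "G n = t n ^ k * ((1 - 2 * u * t n) * (1 - 2 * v * t n) * weight b c lam u v (t n))" for n
  let ?S = "node_sum b c lam u v"
  obtain m where m: "k = Suc m" using k by (cases k) auto
  have t0: "t n \<noteq> 0" for n using u_nonzero q0 by (simp add: t_def)
  have sums: "f k sums ?S k" for k
    unfolding f_def t_def by (rule node_sums')
  have "(\<lambda>n. t n) \<longlonglongrightarrow> u / 2 * 0"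
    unfolding t_def using q1 by (intro tendsto_intros LIMSEQ_power_zero)
  then have tlim: "t \<longlonglongrightarrow> 0" by simp
  have Gf: "G n = u / 2 * (f m n * ((1 - 2 * u * t n) * (1 - 2 * v * t n)))" for n
  proof -
    have "t n ^ k = u / 2 * q ^ n * t n ^ m" by (simp add: m t_def)
    then show ?thesis unfolding G_def f_def by (simp only: mult_ac)
  qed
  \<comment> \<open>Here \<open>k > 0\<close> enters: \<open>G\<close> is a bounded multiple of the summand for \<open>k - 1\<close>, which tends to zero.\<close>
  have "G \<longlonglongrightarrow> u / 2 * (0 * ((1 - 2 * u * 0) * (1 - 2 * v * 0)))"
    unfolding Gf by (intro tendsto_intros tlim summable_LIMSEQ_zero sums_summable[OF sums])
  then have G_lim: "G \<longlonglongrightarrow> 0" by simp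
  \<comment> \<open>At the endpoint \<open>t = u/2\<close> the factor \<open>1 - 2vt\<close> vanishes.\<close>
  have G0: "G 0 = 0" using uv by (simp add: G_def t_def mult.commute)
  have step: "- (1 / 4) * (G n - G (Suc n)) = u / 2 * ((u + v) / 2 * f k n
     - f (k + 1) n - c * q ^ k * f k n - 1 / 4 * (1 + lam * q ^ k / b) * f m n)" for n
  proof -
    define w where "w = t n ^ m * weight b c lam u v (t n)"
    have ts: "t (Suc n) = t n * q" by (simp add: t_def)
    define d where "d = 4 * c * t n + lam / b"
    have "G (Suc n) = (t n ^ k * q ^ k) * (- d * weight b c lam u v (t n))"
      unfolding G_def ts weight_shift[OF t0] power_mult_distrib d_def ..
    then have g1: "G (Suc n) = - (q ^ k * t n * d) * w"
      by (simp add: w_def m mult_ac)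
    have g2: "G n = t n * ((1 - 2 * u * t n) * (1 - 2 * v * t n)) * w"
      by (simp add: G_def w_def m mult_ac)
    have v2: "(1 - 2 * u * t n) * (1 - 2 * v * t n) = 1 - 4 * ((u + v) / 2) * t n + 4 * t n * t n"
    proof -
      have "(1 - 2 * u * t n) * (1 - 2 * v * t n) = 1 - 2 * (u + v) * t n + 4 * (u * v) * t n * t n"
        by (simp add: algebra_simps)
      then show ?thesis using uv by simp
    qed
    have f1: "u / 2 * f m n = t n * w" "u / 2 * f k n = t n * t n * w"
      "u / 2 * f (k + 1) n = t n * t n * t n * w"
      by (simp_all add: f_def w_def m t_def mult_ac)
    have "u / 2 * ((u + v) / 2 * f k n
       - f (k + 1) n - c * q ^ k * f k n - 1 / 4 * (1 + lam * q ^ k / b) * f m n)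
      = (u + v) / 2 * (u / 2 * f k n) - u / 2 * f (k + 1) n - c * q ^ k * (u / 2 * f k n)
        - 1 / 4 * (1 + lam * q ^ k / b) * (u / 2 * f m n)"
      by (simp only: right_diff_distrib mult_ac)
    also have "\<dots> = - (1 / 4) * (G n - G (Suc n))"
      unfolding g1 g2 v2 f1 d_def using b by (simp add: field_simps)
    finally show ?thesis ..
  qed
  have "(\<lambda>n. - (1 / 4) * (G n - G (Suc n))) sums (- (1 / 4) * (G 0 - 0))"
    by (intro sums_mult telescope_sums' G_lim)
  then have "(\<lambda>n. u / 2 * ((u + v) / 2 * f k n
     - f (k + 1) n - c * q ^ k * f k n - 1 / 4 * (1 + lam * q ^ k / b) * f m n)) sums 0"
    unfolding step by (simp add: G0)
  moreover have "(\<lambda>n. u / 2 * ((u + v) / 2 * f k n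
     - f (k + 1) n - c * q ^ k * f k n - 1 / 4 * (1 + lam * q ^ k / b) * f m n)) sums
     (u / 2 * ((u + v) / 2 * ?S k - ?S (k + 1) - c * q ^ k * ?S k - 1 / 4 * (1 + lam * q ^ k / b) * ?S m))"
    by (intro sums_mult sums_diff sums)
  ultimately have "u / 2 * ((u + v) / 2 * ?S k - ?S (k + 1) - c * q ^ k * ?S k
      - 1 / 4 * (1 + lam * q ^ k / b) * ?S m) = 0"
    by (rule sums_unique2[symmetric])
  then have "(u + v) / 2 * ?S k - ?S (k + 1) - c * q ^ k * ?S k
      - 1 / 4 * (1 + lam * q ^ k / b) * ?S m = 0"
    using u_nonzero by simp
  then show ?thesis by (simp add: m algebra_simps)
qed

end

lemma p_fun_eq_node_sums:
  fixes b c lam \<theta> :: complex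
  defines "u \<equiv> exp (\<i> * \<theta>)" and "v \<equiv> exp (- \<i> * \<theta>)"
  shows "p_fun q b c lam \<theta> k = - 2 * (u - v)
     * (qpoch_inf (2 * c * u) q * qpoch_inf (2 * c * v) q
         / (qpoch_inf q q * qpoch_inf (u ^ 2) q * qpoch_inf (v ^ 2) q))
     * (u / 2 * node_sum b c lam u v k - v / 2 * node_sum b c lam v u k)"
proof -
  have q1': "1 - q \<noteq> 0" using q_power_neq_1[of 0] by simp
  have "2 * \<i> * sin \<theta> = u - v" by (simp add: sin_exp_eq u_def v_def)
  moreover have "4 * (- \<i> * sin \<theta>) = - 2 * (2 * \<i> * sin \<theta>)" by simp
  ultimately have s: "4 * (- \<i> * sin \<theta>) = - 2 * (u - v)" by (simp only:)
  have e: "exp (2 * \<i> * \<theta>) = u ^ 2" "exp (- 2 * \<i> * \<theta>) = v ^ 2"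
    using exp_of_nat_mult[of 2 "\<i> * \<theta>"] exp_of_nat_mult[of 2 "- \<i> * \<theta>"]
    by (simp_all add: u_def v_def mult.assoc)
  have "q_integral q (v / 2) (u / 2) (p_integrand q b c lam \<theta> k)
      = (1 - q) * (u / 2 * node_sum b c lam u v k - v / 2 * node_sum b c lam v u k)"
    unfolding q_integral_def p_integrand_eq_weight node_sum_def u_def[symmetric] v_def[symmetric]
      weight_commute[of b c lam v u]
    by (simp add: algebra_simps)
  moreover have "A / (1 - q) * B * ((1 - q) * S) = A * B * S" for A B S
    using q1' by simp
  ultimately show ?thesis
    unfolding p_fun_def s e u_def[symmetric] v_def[symmetric] by (simp only:)
qed

lemma p_fun_recurrence:
  assumes "b \<noteq> 0" "c \<noteq> 0" "norm (lam * q / b) < 1" "k > 0"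
  shows "cos \<theta> * p_fun q b c lam \<theta> k = p_fun q b c lam \<theta> (k + 1) + c * q ^ k * p_fun q b c lam \<theta> k
     + 1 / 4 * (1 + lam * q ^ k / b) * p_fun q b c lam \<theta> (k - 1)"
proof -
  define u v where "u = exp (\<i> * \<theta>)" and "v = exp (- \<i> * \<theta>)"
  have uv: "u * v = 1" "v * u = 1" by (simp_all add: u_def v_def flip: exp_add)
  have x: "cos \<theta> = (u + v) / 2" by (simp add: cos_exp_eq u_def v_def)
  define C where "C = - 2 * (u - v) * (qpoch_inf (2 * c * u) q * qpoch_inf (2 * c * v) q
         / (qpoch_inf q q * qpoch_inf (u ^ 2) q * qpoch_inf (v ^ 2) q))"
  define P where "P = node_sum b c lam u v"
  define R where "R = node_sum b c lam v u"
  have p: "p_fun q b c lam \<theta> k = C * (u / 2 * P k - v / 2 * R k)" for k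
    unfolding p_fun_eq_node_sums C_def P_def R_def u_def v_def ..
  define y U V d where "y = (u + v) / 2" and "U = u / 2" and "V = v / 2"
    and "d = 1 / 4 * (1 + lam * q ^ k / b)"
  note pU = p[folded U_def V_def]
  have r1: "y * P k = P (k + 1) + c * q ^ k * P k + d * P (k - 1)"
    unfolding y_def d_def P_def by (rule node_sum_recurrence[OF assms(1-3) uv(1) assms(4)])
  have r2: "y * R k = R (k + 1) + c * q ^ k * R k + d * R (k - 1)"
    unfolding y_def d_def R_def add.commute[of u v] by (rule node_sum_recurrence[OF assms(1-3) uv(2) assms(4)])
  have "y * p_fun q b c lam \<theta> k = C * (U * (y * P k) - V * (y * R k))"
    unfolding pU by (simp only: right_diff_distrib mult_ac)
  also have "\<dots> = p_fun q b c lam \<theta> (k + 1) + c * q ^ k * p_fun q b c lam \<theta> k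
     + d * p_fun q b c lam \<theta> (k - 1)"
    unfolding pU r1 r2 by (simp add: algebra_simps)
  finally show ?thesis unfolding x y_def d_def .
qed

section \<open>The closed form\<close>

lemma qpoch_inf_nonzero_powi:
  assumes "\<And>m::int. a \<noteq> q powi m"
  shows "qpoch_inf (a * q powi j) q \<noteq> 0"
proof (rule qpoch_inf_nonzero)
  fix i :: nat
  show "a * q powi j * q ^ i \<noteq> 1"
  proof
    assume "a * q powi j * q ^ i = 1"
    then have "a * q powi (j + int i) = 1" using q0 by (simp add: power_int_add mult.assoc)
    then have "a = q powi (- (j + int i))"
      using q0 unfolding power_int_minus_divide by (simp add: eq_divide_eq)
    with assms show False by blast
  qed
qed

text \<open>Replacing the two node sums by lattice series and using quasi-periodicity of theta, the bracket becomes the left-hand side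
  of \<open>lattice_three_term\<close> at \<open>Xq\<^sup>k\<close>, \<open>Yq\<^sup>k\<close>, \<open>zq\<^sup>k\<close>. The remaining factor \<open>theta (v\<^sup>2)\<close> cancels the
  products of \<open>e\<^bsup>\<plusminus>2i\<theta>\<^esup>\<close> in the prefactor of \<open>p_k\<close>, and \<open>-(u - v)u = 1 - u\<^sup>2\<close> cancels the rest.\<close>

lemma p_fun_eq_connection_series:
  fixes b c lam \<theta> :: complex
  defines "u \<equiv> exp (\<i> * \<theta>)" and "v \<equiv> exp (- \<i> * \<theta>)"
  assumes b: "b \<noteq> 0" and c: "c \<noteq> 0" and lam: "norm (lam * q / b) < 1"
    and nd: "p_nondegenerate q c \<theta>"
  shows "p_fun q b c lam \<theta> k = tau (int k) * c ^ k
     / (qpoch_inf (q / (2 * c * u)) q * qpoch_inf (q / (2 * c * v)) q)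
     * connection_series (2 * c * u * q ^ k) (2 * c * v * q ^ k) (- (lam * q / b) * q ^ k)"
proof -
  have uv: "u * v = 1" "v * u = 1" by (simp_all add: u_def v_def flip: exp_add)
  have nz: "u \<noteq> 0" "v \<noteq> 0" by (simp_all add: u_def v_def)
  have e2: "exp (2 * \<i> * \<theta>) = u ^ 2"
    using exp_of_nat_mult[of 2 "\<i> * \<theta>"] by (simp add: u_def mult.assoc)
  define X Y z where "X = 2 * c * u" and "Y = 2 * c * v" and "z = - (lam * q / b) * q ^ k"
  have X: "X \<noteq> 0" and Y: "Y \<noteq> 0" using c nz by (simp_all add: X_def Y_def)
  have Xk: "X * q ^ k \<noteq> 0" and Yk: "Y * q ^ k \<noteq> 0" using X Y q0 by simp_all
  have z: "norm z < 1" unfolding z_def by (rule norm_z_power[OF b c lam uv(1)])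
  have ndu: "u ^ 2 \<noteq> q powi m" and ndX: "X \<noteq> q powi m" and ndY: "Y \<noteq> q powi m" for m :: int
    using nd by (auto simp: p_nondegenerate_def e2 X_def Y_def u_def v_def)
  have inv_nd: "1 / a \<noteq> q powi m" if "\<And>m::int. a \<noteq> q powi m" for a m
  proof
    assume "1 / a = q powi m"
    then have "a = q powi (- m)" by (simp add: power_int_minus inverse_eq_divide flip: \<open>1 / a = q powi m\<close>)
    with that show False by blast
  qed
  have v2: "v ^ 2 = 1 / u ^ 2"
    using uv nz by (simp add: eq_divide_eq flip: power_mult_distrib)
  have P: "qpoch_inf X q \<noteq> 0" "qpoch_inf Y q \<noteq> 0" "qpoch_inf (u ^ 2) q \<noteq> 0"
    "qpoch_inf (q / X) q \<noteq> 0" "qpoch_inf (q / Y) q \<noteq> 0" "qpoch_inf (v ^ 2) q \<noteq> 0"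
    "qpoch_inf (q * u ^ 2) q \<noteq> 0"
    using qpoch_inf_nonzero_powi[of X 0] qpoch_inf_nonzero_powi[of Y 0] qpoch_inf_nonzero_powi[of "u ^ 2" 0]
      qpoch_inf_nonzero_powi[of "1 / X" 1] qpoch_inf_nonzero_powi[of "1 / Y" 1]
      qpoch_inf_nonzero_powi[of "1 / u ^ 2" 0] qpoch_inf_nonzero_powi[of "u ^ 2" 1]
      ndX ndY ndu inv_nd[of X] inv_nd[of Y] inv_nd[of "u ^ 2"]
    by (simp_all add: v2 mult.commute)
  define Ju Jv E where "Ju = lattice_series (X * q ^ k) (Y * q ^ k) z" and "Jv = lattice_series (Y * q ^ k) (X * q ^ k) z"
    and "E = connection_series (X * q ^ k) (Y * q ^ k) z"
  define T where "T = tau (int k) * c ^ k"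
  have thX: "theta X = theta (X * q ^ k) * (tau (int k) * X ^ k)"
    and thY: "theta Y = theta (Y * q ^ k) * (tau (int k) * Y ^ k)"
    using theta_mult_q_power X Y by simp_all
  have cu: "(u / 2) ^ k * Y ^ k = c ^ k" "(v / 2) ^ k * X ^ k = c ^ k"
    using uv by (simp_all add: X_def Y_def mult_ac flip: power_mult_distrib)
  have th_nz: "theta X \<noteq> 0" "theta Y \<noteq> 0" using P by (simp_all add: theta_def)
  have nu: "node_sum b c lam u v k = qpoch_inf q q * T * theta (Y * q ^ k) * Ju / (theta X * theta Y)"
  proof -
    have "node_sum b c lam u v k = (u / 2) ^ k * theta Y * (qpoch_inf q q * Ju) / (theta X * theta Y)"
      unfolding node_sum_eq[OF b c lam uv(1)] X_def[symmetric] Y_def[symmetric] z_def[symmetric] Ju_def[symmetric]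
      using th_nz by simp
    also have "(u / 2) ^ k * theta Y = T * theta (Y * q ^ k)"
      unfolding thY T_def cu(1)[symmetric] by (simp only: mult_ac)
    finally show ?thesis by (simp only: mult_ac)
  qed
  have nv: "node_sum b c lam v u k = qpoch_inf q q * T * theta (X * q ^ k) * Jv / (theta X * theta Y)"
  proof -
    have "node_sum b c lam v u k = (v / 2) ^ k * theta X * (qpoch_inf q q * Jv) / (theta X * theta Y)"
      unfolding node_sum_eq[OF b c lam uv(2)] X_def[symmetric] Y_def[symmetric] z_def[symmetric] Jv_def[symmetric]
      using th_nz by simp
    also have "(v / 2) ^ k * theta X = T * theta (X * q ^ k)"
      unfolding thX T_def cu(2)[symmetric] by (simp only: mult_ac)
    finally show ?thesis by (simp only: mult_ac)
  qed
  have ratio: "Y * q ^ k / (X * q ^ k) = v ^ 2"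
  proof -
    have "Y * q ^ k / (X * q ^ k) = v / u" using c q0 by (simp add: X_def Y_def)
    also have "\<dots> = v ^ 2" using uv nz by (simp add: divide_eq_eq power2_eq_square mult.assoc)
    finally show ?thesis .
  qed
  have key: "theta (Y * q ^ k) * Ju - v ^ 2 * (theta (X * q ^ k) * Jv) = theta (v ^ 2) * E"
    using lattice_three_term[OF Xk Yk z] unfolding ratio Ju_def Jv_def E_def .
  have vu: "v = u * v ^ 2"
    using uv by (simp add: power2_eq_square flip: mult.assoc)
  define D where "D = qpoch_inf q q * T / (theta X * theta Y)"
  have "v / 2 = u / 2 * v ^ 2" using vu by simp
  moreover have "node_sum b c lam u v k = D * (theta (Y * q ^ k) * Ju)"
    "node_sum b c lam v u k = D * (theta (X * q ^ k) * Jv)"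
    unfolding nu nv D_def by simp_all
  ultimately have "u / 2 * node_sum b c lam u v k - v / 2 * node_sum b c lam v u k
      = u / 2 * (D * (theta (Y * q ^ k) * Ju)) - u / 2 * v ^ 2 * (D * (theta (X * q ^ k) * Jv))"
    by (simp only:)
  also have "\<dots> = D * (u / 2) * (theta (Y * q ^ k) * Ju - v ^ 2 * (theta (X * q ^ k) * Jv))"
    by (simp only: right_diff_distrib mult_ac)
  also have "\<dots> = qpoch_inf q q * T / (theta X * theta Y) * (u / 2) * (theta (v ^ 2) * E)"
    unfolding key D_def ..
  finally have diff: "u / 2 * node_sum b c lam u v k - v / 2 * node_sum b c lam v u k
      = qpoch_inf q q * T / (theta X * theta Y) * (u / 2) * (theta (v ^ 2) * E)" .
  have "q / v ^ 2 = q * u ^ 2"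
    using uv nz by (simp add: divide_eq_eq flip: power_mult_distrib)
  then have thv: "theta (v ^ 2) = qpoch_inf (v ^ 2) q * qpoch_inf (q * u ^ 2) q"
    by (simp add: theta_def)
  have u2: "qpoch_inf (u ^ 2) q = (1 - u ^ 2) * qpoch_inf (q * u ^ 2) q"
    using qpoch_inf_Suc[of "u ^ 2"] by (simp add: mult.commute)
  have u2': "1 - u ^ 2 \<noteq> 0" using ndu[of 0] by simp
  have uu: "(u - v) * u = - (1 - u ^ 2)" using uv by (simp add: algebra_simps power2_eq_square)
  have "p_fun q b c lam \<theta> k = - 2 * (u - v) * (qpoch_inf X q * qpoch_inf Y q
         / (qpoch_inf q q * qpoch_inf (u ^ 2) q * qpoch_inf (v ^ 2) q))
      * (qpoch_inf q q * T / (theta X * theta Y) * (u / 2) * (theta (v ^ 2) * E))"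
    unfolding p_fun_eq_node_sums u_def[symmetric] v_def[symmetric] diff X_def Y_def ..
  also have "\<dots> = - ((u - v) * u) * (qpoch_inf X q * qpoch_inf Y q
         / (qpoch_inf q q * ((1 - u ^ 2) * qpoch_inf (q * u ^ 2) q) * qpoch_inf (v ^ 2) q))
      * (qpoch_inf q q * T / (theta X * theta Y) * (qpoch_inf (v ^ 2) q * qpoch_inf (q * u ^ 2) q * E))"
  proof -
    have "- 2 * (u - v) * r * (s * (u / 2) * w) = - ((u - v) * u) * r * (s * w)" for r s w
      by (simp add: algebra_simps)
    then show ?thesis unfolding thv u2 by (simp only:)
  qed
  also have "\<dots> = T / (qpoch_inf (q / X) q * qpoch_inf (q / Y) q) * E"
    unfolding uu theta_def using P u2' by simp
  finally show ?thesis
    unfolding T_def E_def X_def Y_def z_def .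
qed

text \<open>Since \<open>\<bar>v\<bar> \<le> 1\<close> and \<open>\<bar>\<lambda>q/(2bc)\<bar> < 1\<close>, the argument \<open>-\<lambda>qv/(2bc)\<close> lies inside the unit disc and Heine's transformation applies. The
  shifted product \<open>(q/(Yq\<^sup>k);q)\<^sub>\<infinity>\<close> supplies the finite factor \<open>(Y;q)\<^sub>k\<close>.\<close>

lemma p_fun_eq_phi21:
  assumes b: "b \<noteq> 0" and c: "c \<noteq> 0" and lam: "norm (lam * q / b) < 1"
    and nd: "p_nondegenerate q c \<theta>" and lam0: "lam \<noteq> 0"
    and lam': "norm (lam * q / (2 * b * c)) < 1" and v1: "norm (exp (- \<i> * \<theta>)) \<le> 1"
  shows "p_fun q b c lam \<theta> k
     = exp (\<i> * of_nat k * \<theta>) * qpoch (2 * c * exp (- \<i> * \<theta>)) q k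
         * qpoch_inf (- (lam * q / (2 * b * c)) * exp (- \<i> * \<theta>)) q
       / (2 ^ k * qpoch_inf (q / (2 * c) * exp (- \<i> * \<theta>)) q)
       * phi21 (- b * q powi (- int k) / lam) 0
           (q powi (1 - int k) * exp (\<i> * \<theta>) / (2 * c)) q
           (- (lam * q / (2 * b * c)) * exp (- \<i> * \<theta>))"
proof -
  define u v where "u = exp (\<i> * \<theta>)" and "v = exp (- \<i> * \<theta>)"
  have uv: "u * v = 1" "v * u = 1" by (simp_all add: u_def v_def flip: exp_add)
  have nz: "u \<noteq> 0" "v \<noteq> 0" by (simp_all add: u_def v_def)
  have v: "v = 1 / u" using uv nz by (simp add: eq_divide_eq)
  define X Y z where "X = 2 * c * u" and "Y = 2 * c * v" and "z = - (lam * q / b) * q ^ k"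
  define a where "a = - (lam * q / (2 * b * c)) * v"
  have X: "X \<noteq> 0" and Y: "Y \<noteq> 0" using c nz by (simp_all add: X_def Y_def)
  have ndY: "Y \<noteq> q powi m" for m :: int
    using nd by (auto simp: p_nondegenerate_def Y_def v_def)
  have ndY': "1 / Y \<noteq> q powi m" for m :: int
  proof
    assume "1 / Y = q powi m"
    then have "Y = q powi (- m)" by (simp add: power_int_minus inverse_eq_divide flip: \<open>1 / Y = q powi m\<close>)
    with ndY show False by blast
  qed
  have Yinf: "qpoch_inf Y q \<noteq> 0" using qpoch_inf_nonzero_powi[of Y 0] ndY by simp
  have Yinf': "qpoch_inf (q / Y) q \<noteq> 0"
    using qpoch_inf_nonzero_powi[of "1 / Y" 1] ndY' by simp
  have Yk: "q / (Y * q ^ k) = 1 / Y * q powi (1 - int k)"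
    using q0 by (simp add: power_int_diff)
  then have B: "qpoch_inf (q / (Y * q ^ k)) q \<noteq> 0"
    using qpoch_inf_nonzero_powi[of "1 / Y" "1 - int k"] ndY' by simp
  have Xk: "X * q ^ k \<noteq> 0" using X q0 by simp
  have z0: "z \<noteq> 0" using lam0 b q0 by (simp add: z_def)
  have za: "z / (X * q ^ k) = a"
    using b c nz q0 by (simp add: z_def X_def a_def v)
  have "norm a \<le> norm (lam * q / (2 * b * c))"
    unfolding a_def norm_mult norm_minus_cancel using v1 by (intro mult_left_le) (auto simp: v_def)
  then have na: "norm (z / (X * q ^ k)) < 1" unfolding za using lam' by linarith
  have qX: "q / (2 * c) * v = q / X" by (simp add: X_def v)
  have par1: "q / z = - b * q powi (- int k) / lam"
    using lam0 b q0 by (simp add: z_def power_int_minus field_simps)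
  have par2: "q / (Y * q ^ k) = q powi (1 - int k) * u / (2 * c)"
    unfolding Yk using nz c by (simp add: Y_def v)
  have uk: "exp (\<i> * of_nat k * \<theta>) = u ^ k"
    using exp_of_nat_mult[of k "\<i> * \<theta>"] by (simp add: u_def mult_ac)
  have ck: "c ^ k = (u / 2) ^ k * Y ^ k"
    using uv by (simp add: Y_def mult_ac flip: power_mult_distrib)
  define F where "F = phi21 (q / z) 0 (q / (Y * q ^ k)) q a"
  have "p_fun q b c lam \<theta> k = tau (int k) * c ^ k / (qpoch_inf (q / X) q * qpoch_inf (q / Y) q)
      * connection_series (X * q ^ k) (Y * q ^ k) z"
    unfolding X_def Y_def z_def u_def v_def by (rule p_fun_eq_connection_series[OF b c lam nd])
  also have "connection_series (X * q ^ k) (Y * q ^ k) z = qpoch_inf a q * (qpoch_inf (q / (Y * q ^ k)) q * F)"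
    using connection_series_eq_phi21[OF Xk z0 na B] unfolding za F_def .
  also have "tau (int k) * c ^ k / (qpoch_inf (q / X) q * qpoch_inf (q / Y) q)
      * (qpoch_inf a q * (qpoch_inf (q / (Y * q ^ k)) q * F))
    = (u / 2) ^ k * (qpoch_inf (q / (Y * q ^ k)) q * (tau (int k) * Y ^ k)) * qpoch_inf a q
        / (qpoch_inf (q / X) q * qpoch_inf (q / Y) q) * F"
    unfolding ck by (simp add: mult_ac)
  also have "\<dots> = u ^ k * qpoch Y q k * qpoch_inf a q / (2 ^ k * qpoch_inf (q / X) q) * F"
    unfolding qpoch_inf_divide_q_power[OF Y Yinf] using Yinf' by (simp add: power_divide)
  finally have "p_fun q b c lam \<theta> k
      = u ^ k * qpoch Y q k * qpoch_inf a q / (2 ^ k * qpoch_inf (q / X) q) * F" .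
  note res = this[unfolded F_def par1 par2]
  show ?thesis
    using res unfolding uk u_def[symmetric] v_def[symmetric] qX Y_def a_def .
qed

end

lemma p_nondegenerate_uminus:
  assumes "p_nondegenerate q c \<theta>"
  shows "p_nondegenerate q c (- \<theta>)"
  unfolding p_nondegenerate_def
proof (intro allI conjI)
  fix m :: int
  show "exp (2 * \<i> * - \<theta>) \<noteq> q powi m"
  proof
    assume "exp (2 * \<i> * - \<theta>) = q powi m"
    moreover have "exp (2 * \<i> * \<theta>) = inverse (exp (2 * \<i> * - \<theta>))"
      by (simp add: exp_minus)
    ultimately have "exp (2 * \<i> * \<theta>) = q powi (- m)"
      by (simp add: power_int_minus)
    with assms show False unfolding p_nondegenerate_def by blast
  qed
qed (use assms in \<open>simp_all add: p_nondegenerate_def\<close>)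

text \<open>The second closed form is the first one at \<open>-\<theta>\<close>, since \<open>p_k\<close> is even in the angle.\<close>

theorem theorem5p1:
  fixes q b c lam x \<theta> :: complex
  assumes "0 < norm q" and "norm q < 1"
    and "b \<noteq> 0" and "c \<noteq> 0"
    and "norm (lam * q / b) < 1"
    and "x = cos \<theta>"
    and "p_nondegenerate q c \<theta>"
  shows "(\<forall>k>0. x * p_fun q b c lam \<theta> k
             = p_fun q b c lam \<theta> (k + 1) + c * q ^ k * p_fun q b c lam \<theta> k
               + 1 / 4 * (1 + lam * q ^ k / b) * p_fun q b c lam \<theta> (k - 1))
    \<and> (lam \<noteq> 0 \<and> norm (lam * q / (2 * b * c)) < 1 \<longrightarrow>
        (Im x \<ge> 0 \<and> norm (exp (- \<i> * \<theta>)) \<le> 1 \<longrightarrow>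
          (\<forall>k. p_fun q b c lam \<theta> k
             = exp (\<i> * of_nat k * \<theta>) * qpoch (2 * c * exp (- \<i> * \<theta>)) q k
                 * qpoch_inf (- (lam * q / (2 * b * c)) * exp (- \<i> * \<theta>)) q
               / (2 ^ k * qpoch_inf (q / (2 * c) * exp (- \<i> * \<theta>)) q)
               * phi21 (- b * q powi (- int k) / lam) 0
                   (q powi (1 - int k) * exp (\<i> * \<theta>) / (2 * c)) q
                   (- (lam * q / (2 * b * c)) * exp (- \<i> * \<theta>))))
        \<and> (Im x \<le> 0 \<and> norm (exp (\<i> * \<theta>)) \<le> 1 \<longrightarrow>
          (\<forall>k. p_fun q b c lam \<theta> k
             = exp (- \<i> * of_nat k * \<theta>) * qpoch (2 * c * exp (\<i> * \<theta>)) q k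
                 * qpoch_inf (- (lam * q / (2 * b * c)) * exp (\<i> * \<theta>)) q
               / (2 ^ k * qpoch_inf (q / (2 * c) * exp (\<i> * \<theta>)) q)
               * phi21 (- b * q powi (- int k) / lam) 0
                   (q powi (1 - int k) * exp (- \<i> * \<theta>) / (2 * c)) q
                   (- (lam * q / (2 * b * c)) * exp (\<i> * \<theta>)))))"
proof -
  interpret qbase q
    using assms(1,2) by unfold_locales auto
  show ?thesis
  proof (intro conjI impI allI)
    fix k :: nat assume "k > 0"
    then show "x * p_fun q b c lam \<theta> k
             = p_fun q b c lam \<theta> (k + 1) + c * q ^ k * p_fun q b c lam \<theta> k
               + 1 / 4 * (1 + lam * q ^ k / b) * p_fun q b c lam \<theta> (k - 1)"
      unfolding assms(6) by (rule p_fun_recurrence[OF assms(3-5)])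
  next
    fix k
    assume l: "lam \<noteq> 0 \<and> norm (lam * q / (2 * b * c)) < 1"
      and x: "Im x \<ge> 0 \<and> norm (exp (- \<i> * \<theta>)) \<le> 1"
    show "p_fun q b c lam \<theta> k
       = exp (\<i> * of_nat k * \<theta>) * qpoch (2 * c * exp (- \<i> * \<theta>)) q k
           * qpoch_inf (- (lam * q / (2 * b * c)) * exp (- \<i> * \<theta>)) q
         / (2 ^ k * qpoch_inf (q / (2 * c) * exp (- \<i> * \<theta>)) q)
         * phi21 (- b * q powi (- int k) / lam) 0
             (q powi (1 - int k) * exp (\<i> * \<theta>) / (2 * c)) q
             (- (lam * q / (2 * b * c)) * exp (- \<i> * \<theta>))"
      by (rule p_fun_eq_phi21[OF assms(3-5,7) conjunct1[OF l] conjunct2[OF l] conjunct2[OF x]])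
  next
    fix k
    assume l: "lam \<noteq> 0 \<and> norm (lam * q / (2 * b * c)) < 1"
      and x: "Im x \<le> 0 \<and> norm (exp (\<i> * \<theta>)) \<le> 1"
    have "norm (exp (- \<i> * (- \<theta>))) \<le> 1" using x by simp
    from p_fun_eq_phi21[OF assms(3-5) p_nondegenerate_uminus[OF assms(7)] conjunct1[OF l] conjunct2[OF l] this, of k]
    show "p_fun q b c lam \<theta> k
       = exp (- \<i> * of_nat k * \<theta>) * qpoch (2 * c * exp (\<i> * \<theta>)) q k
           * qpoch_inf (- (lam * q / (2 * b * c)) * exp (\<i> * \<theta>)) q
         / (2 ^ k * qpoch_inf (q / (2 * c) * exp (\<i> * \<theta>)) q)
         * phi21 (- b * q powi (- int k) / lam) 0
             (q powi (1 - int k) * exp (- \<i> * \<theta>) / (2 * c)) q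
             (- (lam * q / (2 * b * c)) * exp (\<i> * \<theta>))"
      by (simp only: p_fun_minus mult_minus_left mult_minus_right minus_minus)
  qed
qed

end
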